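(* Let $\varphi(v_0,v_1)$ be a formula in the language $\mathcal{L}_\in$ of set theory. The following statements are equivalent for every cardinal $\kappa$ and every set $x$: (i) $\kappa$ is a regular uncountable cardinal and the set of all ordinals $\lambda<\kappa$ such that $\varphi(\lambda,x)$ holds is stationary in $\kappa$. (ii) For all sufficiently large cardinals $\theta$, there is a small embedding $j:M\longrightarrow \mathrm{H}(\theta)$ for $\kappa$ such that $\varphi(\mathrm{crit}(j),x)$ holds (in $\mathrm{V}$) and $x\in\mathrm{ran}(j)$.
   Context: $\mathrm{H}(\theta)$ is the set of all sets whose transitive closure has cardinality less than $\theta$. An elementary embedding $j:M\to N$ between transitive classes is non-trivial if there is an ordinal $\alpha\in M$ with $j(\alpha)>\alpha$; then $\mathrm{crit}(j)$ denotes the least such ordinal. Given cardinals $\kappa<\theta$, a non-trivial elementary embedding $j:M\to \mathrm{H}(\theta)$ is a small embedding for $\kappa$ if $M\in \mathrm{H}(\theta)$ is transitive and $j(\mathrm{crit}(j))=\kappa$. $\mathrm{ran}(j)$ is the range of $j$. "For all sufficiently large cardinals $\theta$" means: there is an ordinal $\alpha\geq\kappa$ such that the statement holds for all cardinals $\theta>\alpha$. *)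

theory Defs
  imports Main "HOL-Library.Countable_Set" "HOL-Library.Equipollence"
begin

section \<open>The set-theoretic universe\<close>

text \<open>A type of class \<open>zfc\<close> is a universe \<open>V\<close> of sets satisfying ZFC; \<open>elts x\<close> is the
  extension of the set \<open>x\<close>. Separation and replacement range over all HOL predicates and
  functions. Consequently HOL sets of type \<open>'a set\<close> play the role of classes, every subclass of a
  set is a set, and every HOL function restricted to a set is (coded by) a set.\<close>

class zfc =
  fixes elts :: "'a \<Rightarrow> 'a set"
  assumes extensionality: "elts x = elts y \<Longrightarrow> x = y"
    and foundation: "elts x \<noteq> {} \<Longrightarrow> \<exists>y\<in>elts x. elts y \<inter> elts x = {}"
    and pairing: "\<exists>z. elts z = {x, y}"
    and union: "\<exists>z. elts z = (\<Union>y\<in>elts x. elts y)"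
    and power_set: "\<exists>z. elts z = {y. elts y \<subseteq> elts x}"
    and infinity: "\<exists>z. (\<exists>e\<in>elts z. elts e = {}) \<and>
                       (\<forall>y\<in>elts z. \<exists>y'\<in>elts z. elts y' = insert y (elts y))"
    and separation: "\<exists>z. elts z = {y \<in> elts x. P y}"
    and replacement: "\<exists>z. elts z = f ` elts x"
    and choice: "(\<forall>y\<in>elts x. elts y \<noteq> {}) \<Longrightarrow>
                 (\<forall>y\<in>elts x. \<forall>y'\<in>elts x. y \<noteq> y' \<longrightarrow> elts y \<inter> elts y' = {}) \<Longrightarrow>
                 \<exists>c. \<forall>y\<in>elts x. \<exists>!u. u \<in> elts c \<inter> elts y"

definition transitive_class :: "'a::zfc set \<Rightarrow> bool" where
  "transitive_class M \<longleftrightarrow> (\<forall>y\<in>M. elts y \<subseteq> M)"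

text \<open>In view of foundation, an ordinal is a transitive set of transitive sets. For ordinals,
  \<open>\<alpha> < \<beta>\<close> is \<open>\<alpha> \<in> elts \<beta>\<close> and \<open>\<alpha> \<le> \<beta>\<close> is \<open>elts \<alpha> \<subseteq> elts \<beta>\<close>.\<close>

definition Ord :: "'a::zfc \<Rightarrow> bool" where
  "Ord \<alpha> \<longleftrightarrow> transitive_class (elts \<alpha>) \<and> (\<forall>\<beta>\<in>elts \<alpha>. transitive_class (elts \<beta>))"

text \<open>Cardinals are initial ordinals, finite ones included.\<close>

definition Card :: "'a::zfc \<Rightarrow> bool" where
  "Card \<kappa> \<longleftrightarrow> Ord \<kappa> \<and> (\<forall>\<alpha>\<in>elts \<kappa>. \<not> elts \<alpha> \<approx> elts \<kappa>)"

text \<open>The elements of the transitive closure of \<open>x\<close>, the least transitive superset of \<open>x\<close>.\<close>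

definition trcl :: "'a::zfc \<Rightarrow> 'a set" where
  "trcl x = \<Inter>{T. transitive_class T \<and> elts x \<subseteq> T}"

definition H :: "'a::zfc \<Rightarrow> 'a set" where
  "H \<theta> = {x. trcl x \<prec> elts \<theta>}"


section \<open>Formulas of the language of set theory\<close>

text \<open>Variables are named: \<open>v\<^sub>i\<close> is represented by the number \<open>i\<close>. The remaining connectives and
  the universal quantifier are taken as abbreviations.\<close>

datatype fm = Mem nat nat | Eq nat nat | Neg fm | Conj fm fm | Ex nat fm

primrec free_vars :: "fm \<Rightarrow> nat set" where
  "free_vars (Mem i k) = {i, k}"
| "free_vars (Eq i k) = {i, k}"
| "free_vars (Neg p) = free_vars p"
| "free_vars (Conj p q) = free_vars p \<union> free_vars q"
| "free_vars (Ex i p) = free_vars p - {i}"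

primrec sat :: "'a::zfc set \<Rightarrow> fm \<Rightarrow> (nat \<Rightarrow> 'a) \<Rightarrow> bool" where
  "sat M (Mem i k) s \<longleftrightarrow> s i \<in> elts (s k)"
| "sat M (Eq i k) s \<longleftrightarrow> s i = s k"
| "sat M (Neg p) s \<longleftrightarrow> \<not> sat M p s"
| "sat M (Conj p q) s \<longleftrightarrow> sat M p s \<and> sat M q s"
| "sat M (Ex i p) s \<longleftrightarrow> (\<exists>a\<in>M. sat M p (s(i := a)))"

text \<open>Truth of \<open>\<phi>(a,b)\<close> in \<open>V\<close>, for a formula \<open>\<phi>\<close> with free variables among \<open>v\<^sub>0, v\<^sub>1\<close>; the values
  assigned to the other variables are then irrelevant.\<close>

definition holds2 :: "fm \<Rightarrow> 'a::zfc \<Rightarrow> 'a \<Rightarrow> bool" where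
  "holds2 \<phi> a b \<longleftrightarrow> sat UNIV \<phi> (\<lambda>i. if i = 0 then a else b)"


section \<open>Small embeddings\<close>

definition elementary_embedding :: "('a::zfc \<Rightarrow> 'a) \<Rightarrow> 'a set \<Rightarrow> 'a set \<Rightarrow> bool" where
  "elementary_embedding j M N \<longleftrightarrow>
     j ` M \<subseteq> N \<and> (\<forall>p s. range s \<subseteq> M \<longrightarrow> (sat M p s \<longleftrightarrow> sat N p (j \<circ> s)))"

definition nontrivial :: "('a::zfc \<Rightarrow> 'a) \<Rightarrow> 'a set \<Rightarrow> bool" where
  "nontrivial j M \<longleftrightarrow> (\<exists>\<alpha>\<in>M. Ord \<alpha> \<and> \<alpha> \<in> elts (j \<alpha>))"

text \<open>Meaningful only for non-trivial \<open>j\<close>.\<close>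

definition crit :: "('a::zfc \<Rightarrow> 'a) \<Rightarrow> 'a set \<Rightarrow> 'a" where
  "crit j M = (THE \<alpha>. \<alpha> \<in> M \<and> Ord \<alpha> \<and> \<alpha> \<in> elts (j \<alpha>) \<and>
                 (\<forall>\<beta>\<in>M. Ord \<beta> \<and> \<beta> \<in> elts (j \<beta>) \<longrightarrow> elts \<alpha> \<subseteq> elts \<beta>))"

definition small_embedding :: "'a::zfc \<Rightarrow> 'a \<Rightarrow> 'a \<Rightarrow> ('a \<Rightarrow> 'a) \<Rightarrow> bool" where
  "small_embedding \<kappa> \<theta> M j \<longleftrightarrow>
     Card \<kappa> \<and> Card \<theta> \<and> \<kappa> \<in> elts \<theta> \<and>
     M \<in> H \<theta> \<and> transitive_class (elts M) \<and>
     elementary_embedding j (elts M) (H \<theta>) \<and> nontrivial j (elts M) \<and>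
     j (crit j (elts M)) = \<kappa>"


section \<open>Regular cardinals and stationary sets\<close>

text \<open>\<open>cf(\<kappa>) = \<kappa>\<close>: no function from a smaller ordinal into \<open>\<kappa>\<close> is cofinal.\<close>

definition regular_card :: "'a::zfc \<Rightarrow> bool" where
  "regular_card \<kappa> \<longleftrightarrow> Card \<kappa> \<and> infinite (elts \<kappa>) \<and>
     \<not> (\<exists>\<alpha>\<in>elts \<kappa>. \<exists>f. f ` elts \<alpha> \<subseteq> elts \<kappa> \<and>
           (\<forall>\<beta>\<in>elts \<kappa>. \<exists>\<gamma>\<in>elts \<alpha>. elts \<beta> \<subseteq> elts (f \<gamma>)))"

definition unbounded_in :: "'a::zfc set \<Rightarrow> 'a \<Rightarrow> bool" where
  "unbounded_in C \<delta> \<longleftrightarrow> (\<forall>\<alpha>\<in>elts \<delta>. \<exists>\<beta>\<in>C \<inter> elts \<delta>. \<alpha> \<in> elts \<beta>)"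

text \<open>A nonzero ordinal \<open>\<delta>\<close> with a subset unbounded in it in this strict sense is a limit
  ordinal, so the closure condition below concerns limit ordinals only.\<close>

definition club :: "'a::zfc set \<Rightarrow> 'a \<Rightarrow> bool" where
  "club C \<kappa> \<longleftrightarrow> C \<subseteq> elts \<kappa> \<and> unbounded_in C \<kappa> \<and>
     (\<forall>\<delta>\<in>elts \<kappa>. elts \<delta> \<noteq> {} \<and> unbounded_in C \<delta> \<longrightarrow> \<delta> \<in> C)"

definition stationary :: "'a::zfc set \<Rightarrow> 'a \<Rightarrow> bool" where
  "stationary S \<kappa> \<longleftrightarrow> S \<subseteq> elts \<kappa> \<and> (\<forall>C. club C \<kappa> \<longrightarrow> S \<inter> C \<noteq> {})"

end

theory Submission
  imports Defs
begin

text \<open>Small embeddings for \<open>\<kappa>\<close> into \<open>H(\<theta>)\<close> amount to elementary substructures \<open>X\<close> of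
  \<open>H(\<theta>)\<close> of size less than \<open>\<theta>\<close> with \<open>\<kappa> \<in> X\<close> and \<open>X \<inter> \<kappa> = \<lambda> \<in> \<kappa>\<close>: the range of a small
  embedding with critical point \<open>\<lambda>\<close> is such an \<open>X\<close> (\<open>small_embedding_range\<close>), and, for \<open>X\<close> of size
  less than \<open>\<kappa>\<close>, the inverse of the transitive collapse of \<open>X\<close> is a small embedding with range \<open>X\<close>
  and critical point \<open>\<lambda>\<close> (\<open>small_embedding_collapse\<close>).

  From stationarity to embeddings: the ordinals \<open>\<lambda> < \<kappa>\<close> for which the Skolem hull of \<open>\<lambda> \<union> {\<kappa>, x}\<close> in
  \<open>H(\<theta>)\<close> meets \<open>\<kappa>\<close> in \<open>\<lambda>\<close> form a club when \<open>\<kappa>\<close> is regular and uncountable (\<open>club_hull\<close>). Some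
  such \<open>\<lambda>\<close> satisfies \<open>\<phi>(\<lambda>,x)\<close>, and its hull is the required \<open>X\<close>. Any cardinal \<open>\<theta> > \<kappa>\<close>
  with \<open>x \<in> H(\<theta>)\<close> is large enough.

  From embeddings to stationarity: a counterexample to regularity or to stationarity that is definable
  in \<open>H(\<theta>)\<close> from \<open>\<kappa>\<close> and \<open>x\<close> can be chosen in \<open>X\<close>. A cofinal function in \<open>X\<close> on an ordinal below
  \<open>\<kappa>\<close>, hence below \<open>\<lambda>\<close>, takes values in \<open>X \<inter> \<kappa> = \<lambda>\<close> only, so it is bounded by \<open>\<lambda>\<close>
  (\<open>elem_sub_regular\<close>). A club in \<open>X\<close> is unbounded in \<open>\<lambda>\<close> and so contains \<open>\<lambda>\<close>, which satisfies
  \<open>\<phi>(\<lambda>,x)\<close> (\<open>elem_sub_stationary\<close>). The truth of \<open>\<phi>\<close> refers to the universe and not to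
  \<open>H(\<theta>)\<close>; since embeddings exist for all large \<open>\<theta>\<close>, one may take \<open>\<theta>\<close> such that \<open>H(\<theta>)\<close> is an
  elementary substructure of the universe (\<open>reflection\<close>).\<close>

section \<open>Classes that are sets\<close>

definition small :: "'a::zfc set \<Rightarrow> bool" where
  "small A \<longleftrightarrow> (\<exists>z. elts z = A)"

text \<open>The set with extension \<open>A\<close>; meaningful only if \<open>A\<close> is small.\<close>

definition vset :: "'a::zfc set \<Rightarrow> 'a" where
  "vset A = (THE z. elts z = A)"

lemma elts_vset: "small A \<Longrightarrow> elts (vset A) = A"
  unfolding small_def vset_def by (rule theI') (auto intro: ex_ex1I extensionality)

lemma small_elts [simp]: "small (elts x)"
  by (auto simp: small_def)

text \<open>Replacement holds for HOL functions, so a class that injects into a set is itself a set. All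
  later smallness proofs that rest on counting use this.\<close>

lemma small_lepoll:
  fixes A :: "'a::zfc set" and z :: 'a
  assumes "A \<lesssim> elts z" shows "small A"
proof -
  obtain g where g: "A \<subseteq> g ` elts z"
    using assms unfolding lepoll_iff by blast
  obtain z' where "elts z' = g ` elts z"
    using replacement[of g z] by blast
  moreover obtain z'' where "elts z'' = {y \<in> elts z'. y \<in> A}"
    using separation[of z' "\<lambda>y. y \<in> A"] by blast
  ultimately have "elts z'' = A" using g by auto
  then show ?thesis by (auto simp: small_def)
qed

lemma small_lepoll_small: "A \<lesssim> B \<Longrightarrow> small B \<Longrightarrow> small A"
  for A B :: "'a::zfc set"
  using small_lepoll[of A "vset B"] by (simp add: elts_vset)

lemma small_subset: "A \<subseteq> B \<Longrightarrow> small B \<Longrightarrow> small A"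
  for A B :: "'a::zfc set"
  by (rule small_lepoll_small[OF subset_imp_lepoll])

lemma small_image: "small A \<Longrightarrow> small (f ` A)"
  for A :: "'a::zfc set" and f :: "'a \<Rightarrow> 'a"
  by (rule small_lepoll_small[OF image_lepoll])

lemma small_UN:
  fixes A :: "'a::zfc set" and F :: "'a \<Rightarrow> 'a set"
  assumes "small A" "\<And>a. a \<in> A \<Longrightarrow> small (F a)"
  shows "small (\<Union>a\<in>A. F a)"
proof -
  have "small ((\<lambda>a. vset (F a)) ` A)"
    using assms(1) by (rule small_image)
  then obtain z where z: "elts z = (\<lambda>a. vset (F a)) ` A"
    unfolding small_def by blast
  obtain u where "elts u = (\<Union>y\<in>elts z. elts y)"
    using union[of z] by blast
  then have "elts u = (\<Union>a\<in>A. F a)"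
    using assms(2) by (simp add: z elts_vset)
  then show ?thesis unfolding small_def by blast
qed

lemma small_pair: "small {x, y}"
  unfolding small_def by (rule pairing)

lemma small_Un: "small A \<Longrightarrow> small B \<Longrightarrow> small (A \<union> B)"
proof -
  assume A: "small A" and B: "small B"
  have "small (\<Union>a\<in>{vset A, vset B}. elts a)"
    by (rule small_UN[OF small_pair small_elts])
  then show ?thesis
    using A B by (simp add: elts_vset)
qed

lemma mem_irrefl [simp]: "x \<notin> elts x"
proof
  assume x: "x \<in> elts x"
  have s: "elts (vset {x}) = {x}"
    using elts_vset[OF small_pair[of x x]] by simp
  then show False
    using foundation[of "vset {x}"] x unfolding s by auto
qed

lemma ex_infinite_set: "\<exists>z::'a::zfc. infinite (elts z)"
proof -
  obtain z e :: 'a where e: "e \<in> elts z" "elts e = {}"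
    and z: "\<forall>y\<in>elts z. \<exists>y'\<in>elts z. elts y' = insert y (elts y)"
    using infinity by blast
  then obtain S where S: "\<And>y. y \<in> elts z \<Longrightarrow> S y \<in> elts z \<and> elts (S y) = insert y (elts y)"
    by metis
  define f where "f n = (S ^^ n) e" for n
  have fz: "f n \<in> elts z" for n
    by (induction n) (auto simp: f_def e S)
  have fS: "elts (f (Suc n)) = insert (f n) (elts (f n))" for n
    using S[OF fz[of n]] by (simp add: f_def)
  \<comment> \<open>By irreflexivity of membership, the iterated successors form an injective sequence, since each one consists of its
    predecessors.\<close>
  have "elts (f n) = f ` {..<n}" for n
    by (induction n) (auto simp: fS lessThan_Suc, auto simp: f_def e)
  then have "m < n \<Longrightarrow> f m \<noteq> f n" for m n
    using mem_irrefl[of "f n"] by (metis imageI lessThan_iff)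
  then have "inj f"
    by (metis injI linorder_neqE_nat)
  then have "infinite (range f)"
    using finite_imageD by blast
  moreover have "range f \<subseteq> elts z"
    using fz by auto
  ultimately show ?thesis
    using finite_subset by blast
qed

lemma small_countable:
  fixes A :: "'a::zfc set"
  assumes "countable A" shows "small A"
proof -
  obtain z :: 'a where z: "infinite (elts z)"
    using ex_infinite_set[where ?'a = 'a] by blast
  have "A \<lesssim> (UNIV :: nat set)"
    using assms by (auto simp: countable_def lepoll_def)
  also have "(UNIV :: nat set) \<lesssim> elts z"
    using z by (simp add: infinite_le_lepoll)
  finally show ?thesis by (rule small_lepoll)
qed

lemma small_UN_nat: "(\<And>n::nat. small (F n)) \<Longrightarrow> small (\<Union>n. F n)"
proof -
  assume F: "\<And>n. small (F n)"
  have "small (range (\<lambda>n. vset (F n)))"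
    by (rule small_countable) simp
  then have "small (\<Union>z\<in>range (\<lambda>n. vset (F n)). elts z)"
    by (rule small_UN) simp
  then show ?thesis
    using F by (simp add: elts_vset)
qed

text \<open>The foundation axiom speaks of sets only. It excludes descending sequences because the range
  of a sequence is countable and hence a set; well-foundedness for classes follows.\<close>

lemma wf_mem: "wf {(x::'a::zfc, y). x \<in> elts y}"
proof -
  have False if f: "\<And>n. f (Suc n) \<in> elts (f n)" for f :: "nat \<Rightarrow> 'a"
  proof -
    have s: "elts (vset (range f)) = range f"
      by (rule elts_vset) (simp add: small_countable)
    then obtain n where "elts (f n) \<inter> range f = {}"
      using foundation[of "vset (range f)"] by auto
    then show False using f by blast
  qed
  then show ?thesis
    by (auto simp: wf_iff_no_infinite_down_chain)
qed

lemmas mem_induct = wf_induct_rule[OF wf_mem, unfolded mem_Collect_eq prod.case,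
    case_names mem]

lemma mem_minimal:
  fixes a :: "'a::zfc"
  assumes "P a" shows "\<exists>b. P b \<and> (\<forall>y\<in>elts b. \<not> P y)"
  using wf_mem assms unfolding wf_eq_minimal by (metis mem_Collect_eq case_prodI)

lemma mem_asym: "x \<in> elts y \<Longrightarrow> y \<notin> elts x"
  using wf_asym[OF wf_mem, of x y] by simp

text \<open>Mostowski's collapse, without extensionality and hence without injectivity. It is applied to
  a well-order, to produce an ordinal, and to membership on a Skolem hull.\<close>

lemma ex_collapse:
  fixes R :: "('a::zfc \<times> 'a) set"
  assumes wf: "wf R" and small: "\<And>x. small {y. (y, x) \<in> R}"
  shows "\<exists>c :: 'a \<Rightarrow> 'a. \<forall>x. elts (c x) = c ` {y. (y, x) \<in> R}"
proof -
  define F :: "('a \<Rightarrow> 'a) \<Rightarrow> 'a \<Rightarrow> 'a" where "F c x = vset (c ` {y. (y, x) \<in> R})" for c x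
  define c where "c = wfrec R F"
  have "elts (c x) = c ` {y. (y, x) \<in> R}" for x
  proof -
    have "c x = F (cut c R x) x"
      unfolding c_def by (rule wfrec[OF wf])
    also have "\<dots> = vset (c ` {y. (y, x) \<in> R})"
      unfolding F_def by (rule arg_cong[where f = vset], rule image_cong) (simp_all add: cut_apply)
    finally show ?thesis
      by (simp only: elts_vset[OF small_image[OF small]])
  qed
  then show ?thesis by (intro exI[of _ c] allI)
qed


section \<open>Ordinals and cardinals\<close>

lemma Ord_mem: "Ord \<alpha> \<Longrightarrow> \<beta> \<in> elts \<alpha> \<Longrightarrow> Ord \<beta>"
  unfolding Ord_def transitive_class_def by blast

lemma Ord_trans: "Ord \<alpha> \<Longrightarrow> \<beta> \<in> elts \<alpha> \<Longrightarrow> \<gamma> \<in> elts \<beta> \<Longrightarrow> \<gamma> \<in> elts \<alpha>"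
  unfolding Ord_def transitive_class_def by blast

text \<open>Double induction: an element of either ordinal is comparable with the other one, and transitivity
  leaves only that it belongs to it, so incomparable ordinals would be equal by extensionality.\<close>

lemma Ord_comparable:
  fixes \<alpha> \<beta> :: "'a::zfc"
  assumes "Ord \<alpha>" "Ord \<beta>"
  shows "\<alpha> \<in> elts \<beta> \<or> \<alpha> = \<beta> \<or> \<beta> \<in> elts \<alpha>"
  using assms
proof (induction \<alpha> arbitrary: \<beta> rule: mem_induct)
  case (mem \<alpha>)
  note IH\<alpha> = mem
  show ?case
    using \<open>Ord \<beta>\<close>
  proof (induction \<beta> rule: mem_induct)
    case (mem \<beta>)
    have "elts \<alpha> = elts \<beta>" if n: "\<alpha> \<notin> elts \<beta>" "\<beta> \<notin> elts \<alpha>"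
    proof (intro equalityI subsetI)
      fix x assume x: "x \<in> elts \<alpha>"
      then have "x \<in> elts \<beta> \<or> x = \<beta> \<or> \<beta> \<in> elts x"
        using IH\<alpha> mem.prems Ord_mem by blast
      then show "x \<in> elts \<beta>"
        using n x IH\<alpha>(2) Ord_trans by blast
    next
      fix x assume x: "x \<in> elts \<beta>"
      then have "\<alpha> \<in> elts x \<or> \<alpha> = x \<or> x \<in> elts \<alpha>"
        using mem.IH mem.prems Ord_mem by blast
      then show "x \<in> elts \<alpha>"
        using n x mem.prems Ord_trans by blast
    qed
    then show ?case by (metis extensionality)
  qed
qed

lemma Ord_subset_iff:
  assumes "Ord \<alpha>" "Ord \<beta>"
  shows "elts \<alpha> \<subseteq> elts \<beta> \<longleftrightarrow> \<alpha> \<in> elts \<beta> \<or> \<alpha> = \<beta>"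
proof
  assume "elts \<alpha> \<subseteq> elts \<beta>"
  then have "\<beta> \<notin> elts \<alpha>" using mem_irrefl[of \<beta>] by blast
  then show "\<alpha> \<in> elts \<beta> \<or> \<alpha> = \<beta>" using Ord_comparable[OF assms] by blast
next
  assume "\<alpha> \<in> elts \<beta> \<or> \<alpha> = \<beta>"
  then show "elts \<alpha> \<subseteq> elts \<beta>"
    by (elim disjE) (simp_all add: subsetI Ord_trans[OF assms(2)])
qed

lemma Ord_not_mem:
  assumes "Ord \<alpha>" "Ord \<beta>"
  shows "\<beta> \<notin> elts \<alpha> \<longleftrightarrow> elts \<alpha> \<subseteq> elts \<beta>"
  unfolding Ord_subset_iff[OF assms]
  using Ord_comparable[OF assms] by (auto simp: mem_asym)

lemma Ord_Union:
  assumes "\<And>a. a \<in> A \<Longrightarrow> Ord a" "small (\<Union>a\<in>A. elts a)"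
  shows "Ord (vset (\<Union>a\<in>A. elts a))"
  unfolding Ord_def elts_vset[OF assms(2)]
  using assms(1) Ord_trans Ord_mem unfolding transitive_class_def by blast

text \<open>The collapse of a well-order of \<open>z\<close>, which exists by Zermelo's theorem, is an ordinal.\<close>

lemma ex_Ord_eqpoll: "\<exists>\<alpha> :: 'a. Ord \<alpha> \<and> elts \<alpha> \<approx> elts z" for z :: "'a::zfc"
proof -
  obtain r where r: "well_order_on (elts z) r"
    using well_order_on[of "elts z"] by blast
  define R where "R = r - Id"
  have wf: "wf R" and sub: "R \<subseteq> elts z \<times> elts z"
    using r by (auto simp: R_def well_order_on_def linear_order_on_def partial_order_on_def
        preorder_on_def refl_on_def)
  have trans: "trans R"
    using r unfolding R_def well_order_on_def linear_order_on_def partial_order_on_def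
      preorder_on_def by (simp add: trans_diff_Id)
  have total: "x \<in> elts z \<Longrightarrow> y \<in> elts z \<Longrightarrow> x \<noteq> y \<Longrightarrow> (x, y) \<in> R \<or> (y, x) \<in> R" for x y
    using r by (auto simp: R_def well_order_on_def linear_order_on_def total_on_def)
  have "small {y. (y, x) \<in> R}" for x
    using sub by (intro small_subset[OF _ small_elts[of z]]) auto
  from ex_collapse[OF wf this] obtain c :: "'a \<Rightarrow> 'a" where c: "\<And>x. elts (c x) = c ` {y. (y, x) \<in> R}"
    by blast
  define \<alpha> where "\<alpha> = vset (c ` elts z)"
  have \<alpha>: "elts \<alpha> = c ` elts z"
    unfolding \<alpha>_def by (simp add: elts_vset small_image)
  have "inj_on c (elts z)"
  proof (rule inj_onI, rule ccontr)
    fix x y assume "x \<in> elts z" "y \<in> elts z" "c x = c y" "x \<noteq> y"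
    then have "c x \<in> elts (c y) \<or> c y \<in> elts (c x)"
      using total[of x y] unfolding c by blast
    then show False using \<open>c x = c y\<close> by simp
  qed
  then have "elts \<alpha> \<approx> elts z"
    unfolding \<alpha> by (rule inj_on_image_eqpoll_self)
  moreover have "Ord \<alpha>"
    unfolding Ord_def transitive_class_def \<alpha> using sub trans
    by (auto simp: c dest: transD)
  ultimately show ?thesis by blast
qed

lemma Card_Ord: "Card \<kappa> \<Longrightarrow> Ord \<kappa>"
  by (simp add: Card_def)

lemma ex_Card_eqpoll: "\<exists>\<kappa> :: 'a. Card \<kappa> \<and> elts \<kappa> \<approx> elts z" for z :: "'a::zfc"
proof -
  obtain \<alpha> :: 'a where "Ord \<alpha> \<and> elts \<alpha> \<approx> elts z"
    using ex_Ord_eqpoll[of z] by blast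
  from mem_minimal[of "\<lambda>\<alpha>. Ord \<alpha> \<and> elts \<alpha> \<approx> elts z", OF this]
  obtain \<kappa> :: 'a where \<kappa>: "Ord \<kappa>" "elts \<kappa> \<approx> elts z"
    and min: "\<forall>\<beta>\<in>elts \<kappa>. \<not> (Ord \<beta> \<and> elts \<beta> \<approx> elts z)"
    by metis
  then have "Card \<kappa>"
    unfolding Card_def by (meson Ord_mem eqpoll_trans)
  with \<kappa> show ?thesis by blast
qed

lemma Card_mem_lesspoll: "Card \<theta> \<Longrightarrow> \<beta> \<in> elts \<theta> \<Longrightarrow> elts \<beta> \<prec> elts \<theta>"
  unfolding Card_def lesspoll_def by (meson Ord_trans subsetI subset_imp_lepoll)

lemma lesspoll_Ord:
  fixes \<theta> :: "'a::zfc"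
  assumes "A \<prec> elts \<theta>" "Ord \<theta>"
  shows "\<exists>\<beta>\<in>elts \<theta>. elts \<beta> \<approx> A"
proof -
  obtain f where f: "inj_on f A" "f ` A \<subseteq> elts \<theta>"
    using assms(1) by (auto simp: lesspoll_def lepoll_def)
  from f(2) have s: "small (f ` A)"
    by (rule small_subset[OF _ small_elts])
  obtain \<beta> :: 'a where \<beta>: "Ord \<beta>" "elts \<beta> \<approx> f ` A"
    using ex_Ord_eqpoll[of "vset (f ` A)"] by (auto simp: elts_vset[OF s])
  then have e: "elts \<beta> \<approx> A"
    using f by simp
  have "\<beta> \<in> elts \<theta>"
  proof (rule ccontr)
    assume "\<beta> \<notin> elts \<theta>"
    then have "elts \<theta> \<lesssim> elts \<beta>"
      using assms(2) \<beta>(1) by (simp add: Ord_not_mem subset_imp_lepoll)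
    then have "elts \<theta> \<lesssim> A"
      using e by (rule lepoll_trans2)
    with assms(1) have "A \<prec> A"
      by (rule lesspoll_trans2)
    then show False by simp
  qed
  with e show ?thesis by blast
qed

lemma ex_power: "\<exists>p :: 'a. Pow (elts z) \<approx> elts p" for z :: "'a::zfc"
proof -
  obtain p where p: "elts p = {y. elts y \<subseteq> elts z}"
    using power_set by blast
  have "bij_betw elts (elts p) (Pow (elts z))"
  proof (rule bij_betw_imageI)
    show "inj_on elts (elts p)"
      by (rule inj_onI, erule extensionality)
    show "elts ` elts p = Pow (elts z)"
      by (auto simp: p image_iff) (metis elts_vset small_elts small_subset)
  qed
  then have "elts p \<approx> Pow (elts z)"
    by (auto simp: eqpoll_def)
  then show ?thesis
    by (metis eqpoll_sym)
qed

text \<open>Cantor: the cardinal of the power set of \<open>elts z \<union> elts \<alpha>\<close> is as required.\<close>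

lemma ex_Card_greater:
  fixes \<alpha> z :: "'a::zfc"
  assumes "Ord \<alpha>"
  shows "\<exists>\<theta> :: 'a. Card \<theta> \<and> \<alpha> \<in> elts \<theta> \<and> elts z \<prec> elts \<theta>"
proof -
  define w where "w = vset (elts z \<union> elts \<alpha>)"
  have w: "elts w = elts z \<union> elts \<alpha>"
    unfolding w_def by (simp add: elts_vset small_Un)
  obtain p :: 'a where "Pow (elts w) \<approx> elts p"
    using ex_power[of w] by blast
  moreover obtain \<theta> :: 'a where \<theta>: "Card \<theta>" "elts \<theta> \<approx> elts p"
    using ex_Card_eqpoll[of p] by blast
  ultimately have less: "elts w \<prec> elts \<theta>"
    by (meson eqpoll_sym lesspoll_Pow_self lesspoll_eq_trans)
  then have "elts z \<prec> elts \<theta>" "elts \<alpha> \<prec> elts \<theta>"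
    by (auto intro: lesspoll_trans1[OF _ less] simp: w subset_imp_lepoll)
  moreover have "\<alpha> \<in> elts \<theta>"
    using \<open>elts \<alpha> \<prec> elts \<theta>\<close> assms \<theta>(1)
    by (metis Card_Ord Ord_not_mem lesspoll_not_refl lesspoll_trans2 subset_imp_lepoll)
  ultimately show ?thesis using \<theta> by blast
qed

lemma Card_Union:
  assumes "\<And>a. a \<in> A \<Longrightarrow> Card a" "small (\<Union>a\<in>A. elts a)"
  shows "Card (vset (\<Union>a\<in>A. elts a))"
proof -
  have "\<not> elts \<beta> \<approx> (\<Union>a\<in>A. elts a)" if a: "a \<in> A" and \<beta>: "\<beta> \<in> elts a" for a \<beta>
  proof
    assume e: "elts \<beta> \<approx> (\<Union>a\<in>A. elts a)"
    have "elts a \<lesssim> (\<Union>a\<in>A. elts a)"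
      using a by (intro subset_imp_lepoll) auto
    also have "(\<Union>a\<in>A. elts a) \<approx> elts \<beta>"
      using e by (rule eqpoll_sym)
    also have "elts \<beta> \<prec> elts a"
      using assms(1)[OF a] \<beta> by (rule Card_mem_lesspoll)
    finally show False by simp
  qed
  moreover have "Ord (vset (\<Union>a\<in>A. elts a))"
    using assms Card_Ord by (intro Ord_Union) auto
  ultimately show ?thesis
    unfolding Card_def elts_vset[OF assms(2)] by auto
qed


section \<open>Transitive closures and the classes H\<close>

lemma transitive_trcl: "transitive_class (trcl x)"
  unfolding trcl_def transitive_class_def by blast

lemma elts_subset_trcl: "elts x \<subseteq> trcl x"
  unfolding trcl_def by blast

lemma trcl_least: "transitive_class T \<Longrightarrow> elts x \<subseteq> T \<Longrightarrow> trcl x \<subseteq> T"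
  unfolding trcl_def by blast

lemma small_trcl: "small (trcl x)"
proof -
  define F where "F = rec_nat (elts x) (\<lambda>_ T. \<Union>y\<in>T. elts y)"
  have F: "F 0 = elts x" "F (Suc n) = (\<Union>y\<in>F n. elts y)" for n
    by (auto simp: F_def)
  have "small (F n)" for n
    by (induction n) (auto simp: F intro: small_UN)
  then have "small (\<Union>n. F n)"
    by (rule small_UN_nat)
  moreover have "trcl x \<subseteq> (\<Union>n. F n)"
  proof (rule trcl_least)
    show "transitive_class (\<Union>n. F n)"
      unfolding transitive_class_def using F(2) by blast
    show "elts x \<subseteq> (\<Union>n. F n)"
      using F(1) by blast
  qed
  ultimately show ?thesis
    by (rule small_subset[rotated])
qed

lemma H_I: "transitive_class T \<Longrightarrow> elts x \<subseteq> T \<Longrightarrow> T \<prec> elts \<theta> \<Longrightarrow> x \<in> H \<theta>"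
  unfolding H_def using trcl_least[of T x] lesspoll_trans1[OF subset_imp_lepoll] by simp

lemma transitive_H: "transitive_class (H \<theta>)"
  unfolding transitive_class_def
proof (intro ballI subsetI)
  fix x y assume x: "x \<in> H \<theta>" and y: "y \<in> elts x"
  then have "y \<in> trcl x"
    using elts_subset_trcl by blast
  then have "elts y \<subseteq> trcl x"
    using transitive_trcl unfolding transitive_class_def by blast
  moreover have "trcl x \<prec> elts \<theta>"
    using x by (simp add: H_def)
  ultimately show "y \<in> H \<theta>"
    by (intro H_I[OF transitive_trcl])
qed

lemma H_trans: "x \<in> H \<theta> \<Longrightarrow> y \<in> elts x \<Longrightarrow> y \<in> H \<theta>"
  using transitive_H[of \<theta>] unfolding transitive_class_def by blast

lemma H_mono: "elts \<theta> \<subseteq> elts \<theta>' \<Longrightarrow> H \<theta> \<subseteq> H \<theta>'"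
  unfolding H_def using lesspoll_trans2[OF _ subset_imp_lepoll] by auto

lemma Card_mem_H: "Card \<theta> \<Longrightarrow> \<beta> \<in> elts \<theta> \<Longrightarrow> \<beta> \<in> H \<theta>"
  by (rule H_I[of "elts \<beta>"]) (auto simp: Card_mem_lesspoll, auto simp: Card_def Ord_def)

text \<open>An element of \<open>H(\<theta>)\<close> is determined by a copy on \<open>\<theta>\<close> of the membership relation
  of its transitive closure, and there are only set many relations on \<open>\<theta>\<close>.\<close>

lemma small_H:
  fixes \<theta> :: "'a::zfc"
  assumes "infinite (elts \<theta>)" shows "small (H \<theta>)"
proof -
  let ?T = "\<lambda>x. insert x (trcl x)"
  have "\<exists>g. inj_on g (?T x) \<and> g ` ?T x \<subseteq> elts \<theta>" if "x \<in> H \<theta>" for x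
    using less_imp_insert_lepoll[of "trcl x" "elts \<theta>" x] that
    by (auto simp: H_def lepoll_def)
  then obtain g where g: "\<And>x. x \<in> H \<theta> \<Longrightarrow> inj_on (g x) (?T x)"
    "\<And>x. x \<in> H \<theta> \<Longrightarrow> g x ` ?T x \<subseteq> elts \<theta>"
    by metis
  define D where "D x = ({(g x u, g x v) |u v. u \<in> ?T x \<and> v \<in> ?T x \<and> u \<in> elts v}, g x x, g x ` ?T x)"
    for x
  have tr: "u \<in> ?T x" if "v \<in> ?T x" "u \<in> elts v" for u v x
    using that transitive_trcl[of x] elts_subset_trcl[of x] unfolding transitive_class_def
    by (metis insert_iff subsetD)
  have inE: "(g x u, g x v) \<in> fst (D x) \<longleftrightarrow> u \<in> elts v"
    if "x \<in> H \<theta>" "u \<in> ?T x" "v \<in> ?T x" for x u v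
  proof
    assume "(g x u, g x v) \<in> fst (D x)"
    then obtain u' v' where *: "g x u = g x u'" "g x v = g x v'" "u' \<in> ?T x" "v' \<in> ?T x" "u' \<in> elts v'"
      unfolding D_def fst_conv by blast
    have "u = u'" "v = v'"
      using inj_onD[OF g(1)[OF that(1)] *(1) that(2) *(3)]
        inj_onD[OF g(1)[OF that(1)] *(2) that(3) *(4)] by blast+
    then show "u \<in> elts v" using *(5) by simp
  next
    assume "u \<in> elts v"
    then show "(g x u, g x v) \<in> fst (D x)"
      unfolding D_def fst_conv using that(2,3) by blast
  qed
  have "inj_on D (H \<theta>)"
  proof (rule inj_onI)
    fix x y assume x: "x \<in> H \<theta>" and y: "y \<in> H \<theta>" and D: "D x = D y"
    have top: "g x x = g y y" and ran: "g x ` ?T x = g y ` ?T y"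
      using arg_cong[OF D, of "\<lambda>p. fst (snd p)"] arg_cong[OF D, of "\<lambda>p. snd (snd p)"]
      by (simp_all only: D_def fst_conv snd_conv)
    have E: "u \<in> elts v \<longleftrightarrow> u' \<in> elts v'"
      if "u \<in> ?T x" "v \<in> ?T x" "u' \<in> ?T y" "v' \<in> ?T y" "g x u = g y u'" "g x v = g y v'"
      for u v u' v'
    proof -
      have "u \<in> elts v \<longleftrightarrow> (g x u, g x v) \<in> fst (D x)"
        using inE[OF x that(1,2)] by simp
      also have "\<dots> \<longleftrightarrow> (g y u', g y v') \<in> fst (D y)"
        using D that(5,6) by simp
      also have "\<dots> \<longleftrightarrow> u' \<in> elts v'"
        using inE[OF y that(3,4)] by simp
      finally show ?thesis .
    qed
    have "u = u'" if "u \<in> ?T x" "u' \<in> ?T y" "g x u = g y u'" for u u'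
      using that
    proof (induction u arbitrary: u' rule: mem_induct)
      case (mem u)
      have "elts u = elts u'"
      proof (intro equalityI subsetI)
        fix w assume w: "w \<in> elts u"
        then have wT: "w \<in> ?T x" by (rule tr[OF mem.prems(1)])
        then have "g x w \<in> g y ` ?T y" unfolding ran[symmetric] by (rule imageI)
        then obtain w' where w': "w' \<in> ?T y" "g x w = g y w'"
          by (elim imageE) simp
        then have "w' \<in> elts u'"
          using E[OF wT mem.prems(1) w'(1) mem.prems(2) w'(2) mem.prems(3)] w by simp
        then show "w \<in> elts u'" using mem.IH[OF w wT w'] by simp
      next
        fix w' assume w': "w' \<in> elts u'"
        then have wT: "w' \<in> ?T y" by (rule tr[OF mem.prems(2)])
        then have "g y w' \<in> g x ` ?T x" unfolding ran by (rule imageI)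
        then obtain w where w: "w \<in> ?T x" "g x w = g y w'"
          by (elim imageE) simp
        then have wu: "w \<in> elts u"
          using E[OF w(1) mem.prems(1) wT mem.prems(2) w(2) mem.prems(3)] w' by simp
        then show "w' \<in> elts u" using mem.IH[OF wu w(1) wT w(2)] by simp
      qed
      then show ?case by (rule extensionality)
    qed
    from this[OF _ _ top] show "x = y" by simp
  qed
  moreover have "D ` H \<theta> \<subseteq> Pow (elts \<theta> \<times> elts \<theta>) \<times> elts \<theta> \<times> Pow (elts \<theta>)"
    using g(2) unfolding D_def by auto
  ultimately have 1: "H \<theta> \<lesssim> Pow (elts \<theta> \<times> elts \<theta>) \<times> elts \<theta> \<times> Pow (elts \<theta>)"
    unfolding lepoll_def by (intro exI conjI)
  have sq: "A \<times> A \<approx> A" if "infinite A" for A :: "'b set"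
    using that by (simp add: card_of_Times_same_infinite eqpoll_iff_card_of_ordIso)
  obtain f where "bij_betw f (elts \<theta> \<times> elts \<theta>) (elts \<theta>)"
    using sq[OF assms] unfolding eqpoll_def by (rule exE)
  then have "bij_betw (image f) (Pow (elts \<theta> \<times> elts \<theta>)) (Pow (elts \<theta>))"
    by (rule bij_betw_Pow)
  then have "Pow (elts \<theta> \<times> elts \<theta>) \<approx> Pow (elts \<theta>)"
    unfolding eqpoll_def by (rule exI[of _ "image f"])
  then have "Pow (elts \<theta> \<times> elts \<theta>) \<lesssim> Pow (elts \<theta>)"
    by (rule eqpoll_imp_lepoll)
  then have "H \<theta> \<lesssim> Pow (elts \<theta>) \<times> Pow (elts \<theta>) \<times> Pow (elts \<theta>)"
    by (intro lepoll_trans[OF 1] times_lepoll_mono) (simp_all add: lepoll_Pow_self)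
  also have "\<dots> \<approx> Pow (elts \<theta>) \<times> Pow (elts \<theta>)"
    using assms by (intro times_eqpoll_cong eqpoll_refl sq) simp
  also have "\<dots> \<approx> Pow (elts \<theta>)"
    using assms by (intro sq) simp
  finally have 2: "H \<theta> \<lesssim> Pow (elts \<theta>)" .
  obtain p :: 'a where "Pow (elts \<theta>) \<approx> elts p"
    using ex_power[of \<theta>] by blast
  with 2 have "H \<theta> \<lesssim> elts p"
    by (rule lepoll_trans2)
  then show ?thesis
    by (rule small_lepoll)
qed


section \<open>Elementary substructures\<close>

lemma finite_free_vars: "finite (free_vars p)"
  by (induction p) auto

lemma sat_cong: "(\<And>k. k \<in> free_vars p \<Longrightarrow> s k = t k) \<Longrightarrow> sat N p s \<longleftrightarrow> sat N p t"
proof (induction p arbitrary: s t)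
  case (Ex i p)
  have "sat N p (s(i := a)) \<longleftrightarrow> sat N p (t(i := a))" for a
    using Ex.prems by (intro Ex.IH) simp
  then show ?case by simp
next
  case (Neg p)
  then show ?case by (metis free_vars.simps(3) sat.simps(3))
next
  case (Conj p q)
  have "sat N p s \<longleftrightarrow> sat N p t" "sat N q s \<longleftrightarrow> sat N q t"
    using Conj.prems by (auto intro!: Conj.IH)
  then show ?case by simp
qed auto

text \<open>The Tarski--Vaught criterion serves as the definition of an elementary substructure below, as
  both directions of the equivalence use it: the range of a small embedding satisfies it, and Skolem
  hulls are constructed to satisfy it.\<close>

definition elem_sub :: "'a::zfc set \<Rightarrow> 'a set \<Rightarrow> bool" where
  "elem_sub X N \<longleftrightarrow> X \<subseteq> N \<and>
     (\<forall>p i s. range s \<subseteq> X \<longrightarrow> (\<exists>a\<in>N. sat N p (s(i := a))) \<longrightarrow> (\<exists>a\<in>X. sat N p (s(i := a))))"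

lemma elem_sub_subset: "elem_sub X N \<Longrightarrow> X \<subseteq> N"
  by (simp add: elem_sub_def)

lemma elem_sub_witness:
  assumes "elem_sub X N" "range s \<subseteq> X" "a \<in> N" "sat N p (s(i := a))"
  obtains b where "b \<in> X" "sat N p (s(i := b))"
  using assms unfolding elem_sub_def by metis

lemma range_upd: "range s \<subseteq> X \<Longrightarrow> a \<in> X \<Longrightarrow> range (s(i := a)) \<subseteq> X"
  by (auto simp: image_subset_iff)

lemma elem_sub_sat:
  assumes "elem_sub X N"
  shows "range s \<subseteq> X \<Longrightarrow> sat X p s \<longleftrightarrow> sat N p s"
proof (induction p arbitrary: s)
  case (Ex i p)
  have "sat X p (s(i := a)) \<longleftrightarrow> sat N p (s(i := a))" if "a \<in> X" for a
    using Ex.prems that by (intro Ex.IH range_upd)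
  then have "sat X (Ex i p) s \<longleftrightarrow> (\<exists>a\<in>X. sat N p (s(i := a)))"
    by simp
  also have "\<dots> \<longleftrightarrow> (\<exists>a\<in>N. sat N p (s(i := a)))"
    using elem_sub_subset[OF assms] elem_sub_witness[OF assms Ex.prems] by (metis subsetD)
  finally show ?case by simp
qed auto

lemma sat_isomorphic:
  assumes inj: "inj_on c X"
    and mem: "\<And>x y. x \<in> X \<Longrightarrow> y \<in> X \<Longrightarrow> c x \<in> elts (c y) \<longleftrightarrow> x \<in> elts y"
  shows "range s \<subseteq> X \<Longrightarrow> sat (c ` X) p (c \<circ> s) \<longleftrightarrow> sat X p s"
proof (induction p arbitrary: s)
  case (Mem i k)
  then have "s i \<in> X" "s k \<in> X" by auto
  then show ?case by (simp add: mem)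
next
  case (Eq i k)
  then have "s i \<in> X" "s k \<in> X" by auto
  then show ?case by (simp add: inj_on_eq_iff[OF inj])
next
  case (Ex i p)
  have "sat (c ` X) p ((c \<circ> s)(i := c a)) \<longleftrightarrow> sat X p (s(i := a))" if "a \<in> X" for a
    unfolding fun_upd_comp[symmetric] using Ex.prems that by (intro Ex.IH range_upd)
  then show ?case by (simp add: comp_def)
qed auto

definition Impl :: "fm \<Rightarrow> fm \<Rightarrow> fm" where
  "Impl p q = Neg (Conj p (Neg q))"

definition Forall :: "nat \<Rightarrow> fm \<Rightarrow> fm" where
  "Forall i p = Neg (Ex i (Neg p))"

lemma sat_Impl [simp]: "sat N (Impl p q) s \<longleftrightarrow> (sat N p s \<longrightarrow> sat N q s)"
  by (simp add: Impl_def)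

lemma sat_Forall [simp]: "sat N (Forall i p) s \<longleftrightarrow> (\<forall>a\<in>N. sat N p (s(i := a)))"
  by (simp add: Forall_def)


section \<open>Skolem hulls\<close>

text \<open>The list \<open>xs\<close> supplies the values of the first variables, so that arguments are finite. When there
  is no witness, the value is still an element of \<open>N\<close>, which keeps hulls inside \<open>N\<close>.\<close>

definition skolem :: "'a::zfc set \<Rightarrow> fm \<Rightarrow> nat \<Rightarrow> 'a list \<Rightarrow> 'a" where
  "skolem N p i xs = (SOME a. a \<in> N \<and>
     ((\<exists>b\<in>N. sat N p (((!) xs)(i := b))) \<longrightarrow> sat N p (((!) xs)(i := a))))"

lemma
  assumes "N \<noteq> {}"
  shows skolem_mem: "skolem N p i xs \<in> N"
    and sat_skolem: "\<exists>b\<in>N. sat N p (((!) xs)(i := b)) \<Longrightarrow> sat N p (((!) xs)(i := skolem N p i xs))"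
proof -
  have "\<exists>a. a \<in> N \<and> ((\<exists>b\<in>N. sat N p (((!) xs)(i := b))) \<longrightarrow> sat N p (((!) xs)(i := a)))"
    using assms by blast
  from someI_ex[OF this]
  show "skolem N p i xs \<in> N"
    and "\<exists>b\<in>N. sat N p (((!) xs)(i := b)) \<Longrightarrow> sat N p (((!) xs)(i := skolem N p i xs))"
    unfolding skolem_def by blast+
qed

text \<open>An assignment into \<open>X\<close> may be replaced by the list of its values on an initial segment that
  contains the finitely many free variables.\<close>

lemma skolem_closed_elem_sub:
  assumes "X \<subseteq> N" "N \<noteq> {}"
    and closed: "\<And>p i xs. xs \<in> lists X \<Longrightarrow> skolem N p i xs \<in> X"
  shows "elem_sub X N"
  unfolding elem_sub_def
proof (intro conjI allI impI)
  fix p i and s :: "nat \<Rightarrow> 'a"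
  assume s: "range s \<subseteq> X" and ex: "\<exists>a\<in>N. sat N p (s(i := a))"
  obtain n where n: "\<And>k. k \<in> free_vars p \<Longrightarrow> k < n"
    using finite_free_vars[of p] unfolding finite_nat_set_iff_bounded by blast
  define xs where "xs = map s [0..<n]"
  have eq: "sat N p (((!) xs)(i := a)) \<longleftrightarrow> sat N p (s(i := a))" for a
    by (rule sat_cong) (simp add: xs_def n)
  have "xs \<in> lists X"
    using s by (auto simp: xs_def image_subset_iff)
  then have "skolem N p i xs \<in> X"
    by (rule closed)
  moreover have "sat N p (((!) xs)(i := skolem N p i xs))"
    using ex by (intro sat_skolem[OF assms(2)]) (simp only: eq)
  ultimately show "\<exists>a\<in>X. sat N p (s(i := a))"
    unfolding eq by blast
qed (rule assms(1))

inductive_set hull :: "'a::zfc set \<Rightarrow> 'a set \<Rightarrow> 'a set" for N A where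
  hull_base: "a \<in> A \<Longrightarrow> a \<in> hull N A"
| hull_skolem: "xs \<in> lists (hull N A) \<Longrightarrow> skolem N p i xs \<in> hull N A"

lemma hull_least:
  assumes "A \<subseteq> X" and closed: "\<And>p i xs. xs \<in> lists X \<Longrightarrow> skolem N p i xs \<in> X"
  shows "hull N A \<subseteq> X"
proof
  fix a assume "a \<in> hull N A"
  then show "a \<in> X"
  proof (induction rule: hull.induct)
    case (hull_base a)
    then show ?case using assms(1) by blast
  next
    case (hull_skolem xs p i)
    then have "xs \<in> lists X" by (auto simp: in_lists_conv_set)
    then show ?case by (rule closed)
  qed
qed

lemma hull_mono:
  assumes "A \<subseteq> B" shows "hull N A \<subseteq> hull N B"
proof (rule hull_least)
  show "A \<subseteq> hull N B" using assms by (auto intro: hull_base)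
qed (rule hull_skolem)

lemma elem_sub_hull:
  assumes "A \<subseteq> N" "N \<noteq> {}"
  shows "elem_sub (hull N A) N"
proof (rule skolem_closed_elem_sub)
  show "hull N A \<subseteq> N"
    using assms by (intro hull_least skolem_mem)
qed (rule assms(2), rule hull_skolem)

text \<open>Skolem functions have finite argument lists, so hulls commute with unions of chains. This is what
  makes the closure points of a hull operation closed.\<close>

lemma lists_Union_chain:
  assumes "\<C> \<noteq> {}" and chain: "\<And>A B. A \<in> \<C> \<Longrightarrow> B \<in> \<C> \<Longrightarrow> A \<subseteq> B \<or> B \<subseteq> A"
    and "xs \<in> lists (\<Union>\<C>)"
  shows "\<exists>A\<in>\<C>. xs \<in> lists A"
  using assms(3)
proof (induction xs rule: list.induct)
  case Nil
  obtain A where "A \<in> \<C>" using assms(1) by (auto simp: ex_in_conv[symmetric])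
  then show ?case by (intro bexI) simp
next
  case (Cons a l)
  then have "a \<in> \<Union>\<C>" and l: "l \<in> lists (\<Union>\<C>)"
    by (simp_all only: Cons_in_lists_iff)
  then obtain B where B: "a \<in> B" "B \<in> \<C>"
    by (elim UnionE)
  obtain A where A: "A \<in> \<C>" "l \<in> lists A"
    using Cons.IH[OF l] by (elim bexE)
  from chain[OF A(1) B(2)] show ?case
  proof
    assume "A \<subseteq> B"
    then have "a # l \<in> lists B"
      using A(2) B(1) lists_mono[of A B] by auto
    then show ?thesis using B(2) by (intro bexI)
  next
    assume "B \<subseteq> A"
    then have "a # l \<in> lists A"
      using A(2) B(1) by auto
    then show ?thesis using A(1) by (intro bexI)
  qed
qed

lemma hull_Union_chain:
  assumes "\<C> \<noteq> {}" and chain: "\<And>A B. A \<in> \<C> \<Longrightarrow> B \<in> \<C> \<Longrightarrow> A \<subseteq> B \<or> B \<subseteq> A"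
  shows "hull N (\<Union>\<C>) \<subseteq> (\<Union>A\<in>\<C>. hull N A)"
proof (rule hull_least)
  show "\<Union>\<C> \<subseteq> (\<Union>A\<in>\<C>. hull N A)"
    by (auto intro: hull_base)
next
  fix p i xs assume xs: "xs \<in> lists (\<Union>A\<in>\<C>. hull N A)"
  have "\<exists>B\<in>hull N ` \<C>. xs \<in> lists B"
  proof (rule lists_Union_chain[OF _ _ xs])
    show "hull N ` \<C> \<noteq> {}" using assms(1) by simp
    show "A \<subseteq> B \<or> B \<subseteq> A" if A: "A \<in> hull N ` \<C>" and B: "B \<in> hull N ` \<C>" for A B
    proof -
      obtain A' B' where "A = hull N A'" "B = hull N B'" "A' \<in> \<C>" "B' \<in> \<C>"
        using A B by (elim imageE) simp
      then show ?thesis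
        using chain[of A' B'] hull_mono[of A' B' N] hull_mono[of B' A' N] by auto
    qed
  qed
  then obtain A where "A \<in> \<C>" "xs \<in> lists (hull N A)"
    by (elim bexE imageE) simp
  then show "skolem N p i xs \<in> (\<Union>A\<in>\<C>. hull N A)"
    by (intro UN_I hull_skolem)
qed


section \<open>The size of Skolem hulls\<close>

instance fm :: countable
  by countable_datatype

lemma lepoll_iff_card_of: "A \<lesssim> B \<longleftrightarrow> (card_of A, card_of B) \<in> ordLeq"
  by (simp add: lepoll_def card_of_ordLeq)

lemma UN_lepoll_infinite:
  assumes "infinite B" "I \<lesssim> B" "\<And>i. i \<in> I \<Longrightarrow> F i \<lesssim> B"
  shows "(\<Union>i\<in>I. F i) \<lesssim> B"
  using assms unfolding lepoll_iff_card_of by (intro card_of_UNION_ordLeq_infinite) auto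

lemma Times_lepoll_infinite:
  assumes "infinite B" "A \<lesssim> B" "C \<lesssim> B"
  shows "A \<times> C \<lesssim> B"
proof -
  have "A \<times> C \<lesssim> B \<times> B"
    using assms by (intro times_lepoll_mono)
  also have "B \<times> B \<approx> B"
    using assms(1) by (simp add: card_of_Times_same_infinite eqpoll_iff_card_of_ordIso)
  finally show ?thesis .
qed

lemma Un_lepoll_infinite:
  assumes "infinite B" "A \<lesssim> B" "C \<lesssim> B"
  shows "A \<union> C \<lesssim> B"
proof -
  have "A \<union> C = (\<Union>i\<in>(UNIV :: bool set). if i then A else C)"
    by (auto split: if_splits)
  moreover have "\<dots> \<lesssim> B"
    using assms by (intro UN_lepoll_infinite finite_lepoll_infinite[of B "UNIV :: bool set"]) auto
  ultimately show ?thesis by simp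
qed

lemma lists_lepoll_infinite:
  assumes "infinite B" shows "lists B \<lesssim> B"
proof -
  have L: "{xs \<in> lists B. length xs = n} \<lesssim> B" for n
  proof (induction n)
    case 0
    have "{xs \<in> lists B. length xs = 0} = {[]}" by auto
    then show ?case
      using finite_lepoll_infinite[OF assms, of "{[]}"] by simp
  next
    case (Suc n)
    have "{xs \<in> lists B. length xs = Suc n}
        \<subseteq> (\<lambda>(x, xs). x # xs) ` (B \<times> {xs \<in> lists B. length xs = n})"
    proof
      fix xs assume "xs \<in> {xs \<in> lists B. length xs = Suc n}"
      then show "xs \<in> (\<lambda>(x, xs). x # xs) ` (B \<times> {xs \<in> lists B. length xs = n})"
        by (cases xs) (simp_all add: image_iff)
    qed
    then have "{xs \<in> lists B. length xs = Suc n} \<lesssim> B \<times> {xs \<in> lists B. length xs = n}"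
      by (rule subset_image_lepoll)
    also have "\<dots> \<lesssim> B"
      using assms Suc by (intro Times_lepoll_infinite lepoll_refl)
    finally show ?case .
  qed
  have "lists B = (\<Union>n. {xs \<in> lists B. length xs = n})"
    by (simp add: UN_simps[symmetric] set_eq_iff)
  moreover have "\<dots> \<lesssim> B"
    using assms L by (intro UN_lepoll_infinite) (simp_all add: infinite_le_lepoll[symmetric])
  ultimately show ?thesis by simp
qed

lemma skolem_image_lepoll:
  assumes "infinite B" "A \<lesssim> B"
  shows "(\<lambda>(p, i, xs). skolem N p i xs) ` (UNIV \<times> UNIV \<times> lists A) \<lesssim> B"
proof -
  have nat: "(UNIV :: nat set) \<lesssim> B"
    using assms(1) by (simp add: infinite_le_lepoll[symmetric])
  have "(UNIV :: fm set) \<lesssim> (UNIV :: nat set)"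
    unfolding lepoll_def by (rule exI[of _ to_nat]) simp
  then have "(UNIV :: fm set) \<lesssim> B"
    using nat by (rule lepoll_trans)
  moreover have "lists A \<lesssim> B"
    using lists_lepoll_mono[OF assms(2)] lists_lepoll_infinite[OF assms(1)] by (rule lepoll_trans)
  ultimately have "(UNIV :: fm set) \<times> (UNIV :: nat set) \<times> lists A \<lesssim> B"
    using assms(1) nat by (intro Times_lepoll_infinite)
  then show ?thesis
    by (rule lepoll_trans[OF image_lepoll])
qed

text \<open>There are only countably many Skolem functions, so a hull is generated in \<open>\<omega>\<close> steps, none of which
  increases an infinite cardinality.\<close>

lemma hull_lepoll:
  assumes "infinite B" "A \<lesssim> B"
  shows "hull N A \<lesssim> B"
proof -
  define F where "F = rec_nat A (\<lambda>_ X. X \<union> (\<lambda>(p, i, xs). skolem N p i xs) ` (UNIV \<times> UNIV \<times> lists X))"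
  have F0: "F 0 = A"
    and FS: "F (Suc n) = F n \<union> (\<lambda>(p, i, xs). skolem N p i xs) ` (UNIV \<times> UNIV \<times> lists (F n))" for n
    by (simp_all add: F_def)
  have "F n \<lesssim> B" for n
  proof (induction n)
    case (Suc n)
    then show ?case
      unfolding FS using assms(1) by (intro Un_lepoll_infinite skolem_image_lepoll)
  qed (simp add: F0 assms)
  then have "(\<Union>n. F n) \<lesssim> B"
    using assms(1) by (intro UN_lepoll_infinite) (simp_all add: infinite_le_lepoll[symmetric])
  moreover have "hull N A \<subseteq> (\<Union>n. F n)"
  proof (rule hull_least)
    show "A \<subseteq> (\<Union>n. F n)" using F0 by blast
  next
    fix p i xs assume xs: "xs \<in> lists (\<Union>n. F n)"
    have mono: "F m \<subseteq> F n" if "m \<le> n" for m n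
      by (rule lift_Suc_mono_le[of F, OF _ that]) (simp add: FS)
    have "\<exists>X\<in>range F. xs \<in> lists X"
    proof (rule lists_Union_chain[OF _ _ xs])
      show "A \<subseteq> B \<or> B \<subseteq> A" if A: "A \<in> range F" and B: "B \<in> range F" for A B
      proof -
        obtain m n where "A = F m" "B = F n" using A B by (elim rangeE)
        then show ?thesis using nat_le_linear[of m n] mono[of m n] mono[of n m] by auto
      qed
    qed simp
    then obtain n where n: "xs \<in> lists (F n)" by (elim bexE rangeE) simp
    have "skolem N p i xs \<in> F (Suc n)"
      unfolding FS by (rule UnI2, rule rev_image_eqI[of "(p, i, xs)"]) (simp_all add: n)
    then show "skolem N p i xs \<in> (\<Union>n. F n)" by (rule UN_I[OF UNIV_I])
  qed
  ultimately show ?thesis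
    by (metis lepoll_trans subset_imp_lepoll)
qed


section \<open>Reflection\<close>

text \<open>One step of the reflection argument: \<open>H(\<mu>)\<close> is a set, hence so is the class of values on it of the
  Skolem functions of the universe, and some larger \<open>H(\<mu>')\<close> contains all these values.\<close>

lemma ex_Card_skolem:
  fixes \<mu> :: "'a::zfc"
  assumes "Card \<mu>" "infinite (elts \<mu>)"
  shows "\<exists>\<mu>'. (Card \<mu>' \<and> infinite (elts \<mu>')) \<and> \<mu> \<in> elts \<mu>' \<and>
    (\<forall>p i. \<forall>xs\<in>lists (H \<mu>). skolem UNIV p i xs \<in> H \<mu>')"
proof -
  define K where "K = (\<lambda>(p, i, xs). skolem UNIV p i xs) ` (UNIV \<times> UNIV \<times> lists (H \<mu>))"
  have "elts \<mu> \<subseteq> H \<mu>"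
    using Card_mem_H[OF assms(1)] by (rule subsetI)
  then have "infinite (H \<mu>)"
    by (rule infinite_super[OF _ assms(2)])
  then have "K \<lesssim> H \<mu>"
    unfolding K_def by (rule skolem_image_lepoll) simp
  then have "small K"
    using small_H[OF assms(2)] by (rule small_lepoll_small)
  then have small: "small (\<Union>y\<in>K. trcl y)"
    by (rule small_UN) (rule small_trcl)
  obtain \<mu>' :: 'a where \<mu>': "Card \<mu>'" "\<mu> \<in> elts \<mu>'" "(\<Union>y\<in>K. trcl y) \<prec> elts \<mu>'"
    using ex_Card_greater[OF Card_Ord[OF assms(1)], of "vset (\<Union>y\<in>K. trcl y)"]
    unfolding elts_vset[OF small] by blast
  have K: "K \<subseteq> H \<mu>'"
  proof
    fix y assume "y \<in> K"
    then have "trcl y \<lesssim> (\<Union>y\<in>K. trcl y)"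
      by (intro subset_imp_lepoll) blast
    then show "y \<in> H \<mu>'"
      unfolding H_def using lesspoll_trans1[OF _ \<mu>'(3)] by simp
  qed
  have "skolem UNIV p i xs \<in> H \<mu>'" if "xs \<in> lists (H \<mu>)" for p i xs
  proof (rule subsetD[OF K])
    have "(p, i, xs) \<in> UNIV \<times> UNIV \<times> lists (H \<mu>)" using that by simp
    then show "skolem UNIV p i xs \<in> K"
      unfolding K_def by (rule rev_image_eqI) simp
  qed
  moreover have "elts \<mu> \<subseteq> elts \<mu>'"
    using Ord_trans[OF Card_Ord[OF \<mu>'(1)] \<mu>'(2)] by (rule subsetI)
  then have "infinite (elts \<mu>')"
    by (rule infinite_super[OF _ assms(2)])
  ultimately show ?thesis using \<mu>'(1,2) by (intro exI[of _ \<mu>']) simp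
qed

text \<open>Satisfaction of formulas in the universe is a HOL predicate to which replacement applies, so
  reflection holds for all formulas at once: the supremum of \<open>\<omega>\<close> steps as above is closed under all
  Skolem functions of the universe. At a limit of cardinals \<open>H\<close> is the union of its earlier stages,
  because the transitive closure of an element has the size of some smaller ordinal.\<close>

theorem reflection:
  fixes \<alpha> :: "'a::zfc"
  assumes "Ord \<alpha>"
  shows "\<exists>\<theta>. Card \<theta> \<and> \<alpha> \<in> elts \<theta> \<and> elem_sub (H \<theta>) UNIV"
proof -
  obtain z :: 'a where z: "infinite (elts z)"
    using ex_infinite_set[where ?'a = 'a] by blast
  obtain \<mu>0 :: 'a where \<mu>0: "Card \<mu>0" "\<alpha> \<in> elts \<mu>0" "elts z \<prec> elts \<mu>0"
    using ex_Card_greater[OF assms, of z] by blast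
  have inf: "infinite (elts \<mu>0)"
    using z unfolding infinite_le_lepoll by (rule lepoll_trans[OF _ lesspoll_imp_lepoll[OF \<mu>0(3)]])
  obtain nx where nx: "\<And>\<mu> :: 'a. Card \<mu> \<Longrightarrow> infinite (elts \<mu>) \<Longrightarrow>
      (Card (nx \<mu>) \<and> infinite (elts (nx \<mu>))) \<and> \<mu> \<in> elts (nx \<mu>) \<and>
      (\<forall>p i. \<forall>xs\<in>lists (H \<mu>). skolem UNIV p i xs \<in> H (nx \<mu>))"
    using ex_Card_skolem by metis
  define \<mu> where "\<mu> n = (nx ^^ n) \<mu>0" for n
  have \<mu>_0: "\<mu> 0 = \<mu>0" and \<mu>_Suc: "\<mu> (Suc n) = nx (\<mu> n)" for n
    by (simp_all add: \<mu>_def)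
  have CI: "Card (\<mu> n) \<and> infinite (elts (\<mu> n))" for n
    by (induction n) (simp_all add: \<mu>_0 \<mu>_Suc \<mu>0 inf nx)
  then have Card: "Card (\<mu> n)" for n
    by simp
  have mem: "\<mu> n \<in> elts (\<mu> (Suc n))" for n
    unfolding \<mu>_Suc using nx[of "\<mu> n"] CI[of n] by simp
  have skolem: "skolem UNIV p i xs \<in> H (\<mu> (Suc n))" if "xs \<in> lists (H (\<mu> n))" for n p i xs
    unfolding \<mu>_Suc using nx[of "\<mu> n"] CI[of n] that by simp
  have mono: "elts (\<mu> m) \<subseteq> elts (\<mu> n)" if "m \<le> n" for m n
  proof (rule lift_Suc_mono_le[of "\<lambda>n. elts (\<mu> n)", OF _ that])
    show "elts (\<mu> n) \<subseteq> elts (\<mu> (Suc n))" for n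
      by (rule subsetI) (rule Ord_trans[OF Card_Ord[OF Card] mem])
  qed
  define \<theta> where "\<theta> = vset (\<Union>n. elts (\<mu> n))"
  have small: "small (\<Union>n. elts (\<mu> n))"
    by (rule small_UN_nat) simp
  then have \<theta>: "elts \<theta> = (\<Union>n. elts (\<mu> n))"
    unfolding \<theta>_def by (rule elts_vset)
  have C\<theta>: "Card \<theta>"
  proof -
    have eq: "(\<Union>a\<in>range \<mu>. elts a) = (\<Union>n. elts (\<mu> n))"
      by (simp add: image_image)
    have "Card (vset (\<Union>a\<in>range \<mu>. elts a))"
    proof (rule Card_Union)
      show "small (\<Union>a\<in>range \<mu>. elts a)" unfolding eq by (rule small)
      show "Card a" if "a \<in> range \<mu>" for a using that Card by (elim rangeE) simp
    qed
    then show ?thesis unfolding \<theta>_def eq .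
  qed
  have H\<theta>: "H \<theta> = (\<Union>n. H (\<mu> n))"
  proof (intro equalityI subsetI)
    fix y assume "y \<in> H \<theta>"
    then have "trcl y \<prec> elts \<theta>" by (simp add: H_def)
    then obtain \<beta> where \<beta>: "\<beta> \<in> elts \<theta>" "elts \<beta> \<approx> trcl y"
      using lesspoll_Ord[OF _ Card_Ord[OF C\<theta>]] by blast
    then obtain n where "\<beta> \<in> elts (\<mu> n)" unfolding \<theta> by blast
    then have "elts \<beta> \<prec> elts (\<mu> n)" by (rule Card_mem_lesspoll[OF Card])
    with eqpoll_sym[OF \<beta>(2)] have "trcl y \<prec> elts (\<mu> n)" by (rule eq_lesspoll_trans)
    then show "y \<in> (\<Union>n. H (\<mu> n))" by (auto simp: H_def)
  next
    fix y assume "y \<in> (\<Union>n. H (\<mu> n))"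
    then obtain n where n: "y \<in> H (\<mu> n)" by (rule UN_E)
    have "elts (\<mu> n) \<subseteq> elts \<theta>" unfolding \<theta> by (rule UN_upper) simp
    from subsetD[OF H_mono[OF this] n] show "y \<in> H \<theta>" .
  qed
  have "elem_sub (H \<theta>) UNIV"
  proof (rule skolem_closed_elem_sub)
    fix p i xs assume "xs \<in> lists (H \<theta>)"
    then have xs: "xs \<in> lists (\<Union>(range (\<lambda>n. H (\<mu> n))))"
      by (simp add: H\<theta>)
    have "\<exists>X\<in>range (\<lambda>n. H (\<mu> n)). xs \<in> lists X"
    proof (rule lists_Union_chain[OF _ _ xs])
      show "A \<subseteq> B \<or> B \<subseteq> A" if A: "A \<in> range (\<lambda>n. H (\<mu> n))" and B: "B \<in> range (\<lambda>n. H (\<mu> n))" for A B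
      proof -
        obtain m n where "A = H (\<mu> m)" "B = H (\<mu> n)" using A B by (elim rangeE)
        then show ?thesis
          using nat_le_linear[of m n] H_mono[OF mono[of m n]] H_mono[OF mono[of n m]] by auto
      qed
    qed simp
    then obtain n where "xs \<in> lists (H (\<mu> n))" by (elim bexE rangeE) simp
    then have "skolem UNIV p i xs \<in> H (\<mu> (Suc n))" by (rule skolem)
    then show "skolem UNIV p i xs \<in> H \<theta>"
      unfolding H\<theta> by (rule UN_I[OF UNIV_I])
  qed simp_all
  moreover have "\<alpha> \<in> elts \<theta>"
    using \<mu>0(2) UN_I[of 0 UNIV \<alpha> "\<lambda>n. elts (\<mu> n)"] unfolding \<theta> \<mu>_0 by simp
  ultimately show ?thesis using C\<theta> by blast
qed


section \<open>The range of a small embedding\<close>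

text \<open>The unique description in the definition of the critical point is met by a membership-minimal
  ordinal that is moved.\<close>

lemma crit_least:
  assumes "nontrivial j M"
  shows "crit j M \<in> M \<and> Ord (crit j M) \<and> crit j M \<in> elts (j (crit j M)) \<and>
    (\<forall>\<beta>\<in>M. Ord \<beta> \<and> \<beta> \<in> elts (j \<beta>) \<longrightarrow> elts (crit j M) \<subseteq> elts \<beta>)"
proof -
  let ?P = "\<lambda>\<alpha>. \<alpha> \<in> M \<and> Ord \<alpha> \<and> \<alpha> \<in> elts (j \<alpha>)"
  obtain \<alpha> where "?P \<alpha>"
    using assms by (auto simp: nontrivial_def)
  from mem_minimal[of ?P, OF this] obtain l where l: "?P l" and min: "\<forall>y\<in>elts l. \<not> ?P y"
    by (elim exE conjE) metis
  have least: "elts l \<subseteq> elts \<beta>" if "\<beta> \<in> M" "Ord \<beta> \<and> \<beta> \<in> elts (j \<beta>)" for \<beta>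
    using min l that Ord_not_mem[of l \<beta>] by auto
  show ?thesis
    unfolding crit_def
  proof (rule theI[of _ l])
    show "l \<in> M \<and> Ord l \<and> l \<in> elts (j l) \<and> (\<forall>\<beta>\<in>M. Ord \<beta> \<and> \<beta> \<in> elts (j \<beta>) \<longrightarrow> elts l \<subseteq> elts \<beta>)"
      using l least by simp
  next
    fix l' assume l': "l' \<in> M \<and> Ord l' \<and> l' \<in> elts (j l') \<and>
      (\<forall>\<beta>\<in>M. Ord \<beta> \<and> \<beta> \<in> elts (j \<beta>) \<longrightarrow> elts l' \<subseteq> elts \<beta>)"
    have "elts l' \<subseteq> elts l" using l' l by simp
    moreover have "elts l \<subseteq> elts l'" using l' least by simp
    ultimately show "l' = l" by (intro extensionality equalityI)
  qed
qed

text \<open>A witness in the target for parameters in the range reflects to a witness in the domain; its image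
  is then a witness in the range.\<close>

lemma elementary_embedding_range:
  assumes "elementary_embedding j M N"
  shows "elem_sub (j ` M) N"
  unfolding elem_sub_def
proof (intro conjI allI impI)
  show "j ` M \<subseteq> N" using assms by (simp add: elementary_embedding_def)
  fix p i s assume s: "range s \<subseteq> j ` M" and ex: "\<exists>a\<in>N. sat N p (s(i := a))"
  have sat: "sat M q t \<longleftrightarrow> sat N q (j \<circ> t)" if "range t \<subseteq> M" for q t
    using assms that by (simp add: elementary_embedding_def)
  define t where "t k = inv_into M j (s k)" for k
  have sk: "s k \<in> j ` M" for k using s by auto
  have t: "range t \<subseteq> M" unfolding t_def using inv_into_into[OF sk] by auto
  have jt: "j \<circ> t = s" unfolding t_def comp_def using f_inv_into_f[OF sk] by simp
  have "sat N (Ex i p) (j \<circ> t)" using ex jt by simp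
  then have "sat M (Ex i p) t" using sat[OF t] by blast
  then obtain b where b: "b \<in> M" "sat M p (t(i := b))" by auto
  then have "sat N p (j \<circ> t(i := b))" using sat[OF range_upd[OF t b(1)]] by blast
  then have "sat N p (s(i := j b))" unfolding fun_upd_comp jt .
  then show "\<exists>a\<in>j ` M. sat N p (s(i := a))" using b(1) by blast
qed

text \<open>All that the passage from small embeddings to stationarity needs to know about \<open>j\<close>: its range is
  an elementary substructure of \<open>H(\<theta>)\<close> that contains \<open>\<kappa>\<close> and meets it in the critical point.
  The ordinals below the critical point are fixed, by induction, since \<open>j\<close> preserves membership.\<close>

lemma small_embedding_range:
  fixes \<kappa> \<theta> M :: "'a::zfc"
  assumes emb: "small_embedding \<kappa> \<theta> M j"
  shows "elem_sub (j ` elts M) (H \<theta>)" "crit j (elts M) \<in> elts \<kappa>" "\<kappa> \<in> j ` elts M"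
    "j ` elts M \<inter> elts \<kappa> = elts (crit j (elts M))"
proof -
  let ?l = "crit j (elts M)"
  have \<kappa>: "Ord \<kappa>" and tr: "transitive_class (elts M)" and el: "elementary_embedding j (elts M) (H \<theta>)"
    and nt: "nontrivial j (elts M)" and jl: "j ?l = \<kappa>"
    using emb by (simp_all add: small_embedding_def Card_Ord)
  show "elem_sub (j ` elts M) (H \<theta>)"
    using el by (rule elementary_embedding_range)
  have l: "?l \<in> elts M" "Ord ?l" "?l \<in> elts (j ?l)"
    and least: "\<And>\<beta>. \<beta> \<in> elts M \<Longrightarrow> Ord \<beta> \<Longrightarrow> \<beta> \<in> elts (j \<beta>) \<Longrightarrow> elts ?l \<subseteq> elts \<beta>"
    using crit_least[OF nt] by simp_all
  show "?l \<in> elts \<kappa>" using l(3) jl by simp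
  show "\<kappa> \<in> j ` elts M" using l(1) jl by (intro rev_image_eqI[of ?l]) simp_all
  have memj: "j y \<in> elts (j z) \<longleftrightarrow> y \<in> elts z" if "y \<in> elts M" "z \<in> elts M" for y z
  proof -
    let ?s = "\<lambda>k::nat. if k = 0 then y else z"
    have "range ?s \<subseteq> elts M" using that by auto
    then have "sat (elts M) (Mem 0 1) ?s \<longleftrightarrow> sat (H \<theta>) (Mem 0 1) (j \<circ> ?s)"
      using el unfolding elementary_embedding_def by blast
    then show ?thesis by simp
  qed
  have M: "y \<in> elts M" if "y \<in> elts ?l" for y
    using tr l(1) that unfolding transitive_class_def by blast
  have fix_below: "j \<beta> = \<beta>" if "\<beta> \<in> elts ?l" for \<beta>
    using that
  proof (induction \<beta> rule: mem_induct)
    case (mem \<beta>)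
    have \<beta>: "\<beta> \<in> elts M" "Ord \<beta>" using M mem.prems Ord_mem[OF l(2)] by simp_all
    have "j \<beta> \<in> elts \<kappa>" using memj[OF \<beta>(1) l(1)] mem.prems jl by simp
    then have o: "Ord (j \<beta>)" by (rule Ord_mem[OF \<kappa>])
    have "elts \<beta> \<subseteq> elts (j \<beta>)"
    proof
      fix \<gamma> assume g: "\<gamma> \<in> elts \<beta>"
      then have gl: "\<gamma> \<in> elts ?l" by (rule Ord_trans[OF l(2) mem.prems])
      then have "j \<gamma> = \<gamma>" by (rule mem.IH[OF g])
      then show "\<gamma> \<in> elts (j \<beta>)" using memj[OF M[OF gl] \<beta>(1)] g by simp
    qed
    moreover have "\<beta> \<notin> elts (j \<beta>)"
      using least[OF \<beta>] mem.prems mem_irrefl[of \<beta>] by blast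
    ultimately show ?case using Ord_subset_iff[OF \<beta>(2) o] by simp
  qed
  show "j ` elts M \<inter> elts \<kappa> = elts ?l"
  proof (intro equalityI subsetI)
    fix u assume "u \<in> j ` elts M \<inter> elts \<kappa>"
    then obtain \<beta> where \<beta>: "\<beta> \<in> elts M" "u = j \<beta>" "j \<beta> \<in> elts (j ?l)" using jl by auto
    then have "\<beta> \<in> elts ?l" using memj[OF \<beta>(1) l(1)] by simp
    then show "u \<in> elts ?l" using fix_below \<beta>(2) by simp
  next
    fix u assume u: "u \<in> elts ?l"
    then have "j u \<in> elts (j ?l)" using memj[OF M[OF u] l(1)] by simp
    then show "u \<in> j ` elts M \<inter> elts \<kappa>"
      using fix_below[OF u] M[OF u] jl by (simp add: rev_image_eqI[of u])
  qed
qed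


section \<open>Small embeddings give regularity and stationarity\<close>

text \<open>On a finite set the converse of membership is well-founded as well, which yields a maximal
  element.\<close>

lemma infinite_if_no_max:
  fixes \<delta> :: "'a::zfc"
  assumes "elts \<delta> \<noteq> {}" and "\<And>\<alpha>. \<alpha> \<in> elts \<delta> \<Longrightarrow> \<exists>\<beta>\<in>elts \<delta>. \<alpha> \<in> elts \<beta>"
  shows "infinite (elts \<delta>)"
proof
  assume fin: "finite (elts \<delta>)"
  define r where "r = {(x, y). x \<in> elts y} \<inter> elts \<delta> \<times> elts \<delta>"
  have "wf r" unfolding r_def by (rule wf_subset[OF wf_mem]) simp
  then have "acyclic r" by (rule wf_acyclic)
  moreover have "finite r" unfolding r_def using fin by simp
  ultimately have wf: "wf (r\<inverse>)" by (intro finite_acyclic_wf_converse)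
  obtain a where "a \<in> elts \<delta>" using assms(1) by auto
  then obtain m where m: "m \<in> elts \<delta>" and max: "\<And>y. (y, m) \<in> r\<inverse> \<Longrightarrow> y \<notin> elts \<delta>"
    by (rule wfE_min[OF wf]) blast
  obtain b where "b \<in> elts \<delta>" "m \<in> elts b" using assms(2)[OF m] by (elim bexE)
  then show False using max[of b] m by (simp add: r_def)
qed

text \<open>Elements of \<open>H(\<theta>)\<close> have to stand for functions \<open>f : \<alpha> \<rightarrow> \<kappa>\<close>. The set of all
  \<open>{{\<gamma>, \<kappa>}, f \<gamma>}\<close> for \<open>\<gamma> < \<alpha>\<close> is decoded by a shorter formula than one with Kuratowski pairs:
  \<open>{\<gamma>, \<kappa>}\<close> is recognised among the two elements as the one that contains \<open>\<kappa>\<close>, and the other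
  one is an ordinal below \<open>\<kappa>\<close>.\<close>

definition code_fun :: "'a::zfc \<Rightarrow> 'a \<Rightarrow> ('a \<Rightarrow> 'a) \<Rightarrow> 'a" where
  "code_fun \<kappa> \<alpha> f = vset ((\<lambda>\<gamma>. vset {vset {\<gamma>, \<kappa>}, f \<gamma>}) ` elts \<alpha>)"

text \<open>The relation \<open>f \<gamma> = \<delta>\<close> for the function \<open>f\<close> coded by \<open>F\<close>, as it is expressed inside \<open>N\<close>.\<close>

definition code_app :: "'a::zfc set \<Rightarrow> 'a \<Rightarrow> 'a \<Rightarrow> 'a \<Rightarrow> 'a \<Rightarrow> bool" where
  "code_app N \<kappa> F \<gamma> \<delta> \<longleftrightarrow>
     (\<exists>p\<in>N. p \<in> elts F \<and> \<delta> \<in> elts p \<and> (\<exists>u\<in>N. u \<in> elts p \<and> \<gamma> \<in> elts u \<and> \<kappa> \<in> elts u))"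

lemma elts_code_fun: "elts (code_fun \<kappa> \<alpha> f) = (\<lambda>\<gamma>. vset {vset {\<gamma>, \<kappa>}, f \<gamma>}) ` elts \<alpha>"
  unfolding code_fun_def by (rule elts_vset[OF small_image[OF small_elts]])

text \<open>Together with \<open>\<kappa>\<close> and its elements, the members of the code and their members form a
  transitive set of the size of \<open>\<kappa>\<close>.\<close>

lemma code_fun_mem_H:
  fixes \<kappa> \<theta> \<alpha> :: "'a::zfc"
  assumes "Ord \<kappa>" "infinite (elts \<kappa>)" "Card \<theta>" "\<kappa> \<in> elts \<theta>" "\<alpha> \<in> elts \<kappa>" "f ` elts \<alpha> \<subseteq> elts \<kappa>"
  shows "code_fun \<kappa> \<alpha> f \<in> H \<theta>"
proof (rule H_I)
  let ?T = "elts (code_fun \<kappa> \<alpha> f) \<union> ((\<lambda>\<gamma>. vset {\<gamma>, \<kappa>}) ` elts \<alpha> \<union> insert \<kappa> (elts \<kappa>))"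
  have \<alpha>: "\<gamma> \<in> elts \<kappa>" if "\<gamma> \<in> elts \<alpha>" for \<gamma>
    using Ord_trans[OF assms(1,5) that] .
  show "transitive_class ?T"
    unfolding transitive_class_def elts_code_fun
  proof (intro ballI)
    fix y assume "y \<in> (\<lambda>\<gamma>. vset {vset {\<gamma>, \<kappa>}, f \<gamma>}) ` elts \<alpha> \<union>
      ((\<lambda>\<gamma>. vset {\<gamma>, \<kappa>}) ` elts \<alpha> \<union> insert \<kappa> (elts \<kappa>))"
    then consider \<gamma> where "\<gamma> \<in> elts \<alpha>" "y = vset {vset {\<gamma>, \<kappa>}, f \<gamma>}"
      | \<gamma> where "\<gamma> \<in> elts \<alpha>" "y = vset {\<gamma>, \<kappa>}" | "y = \<kappa>" | "y \<in> elts \<kappa>"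
      by blast
    then show "elts y \<subseteq> (\<lambda>\<gamma>. vset {vset {\<gamma>, \<kappa>}, f \<gamma>}) ` elts \<alpha> \<union>
      ((\<lambda>\<gamma>. vset {\<gamma>, \<kappa>}) ` elts \<alpha> \<union> insert \<kappa> (elts \<kappa>))"
    proof cases
      case (1 \<gamma>)
      then have "f \<gamma> \<in> elts \<kappa>" using assms(6) by blast
      then show ?thesis using 1 by (simp add: elts_vset[OF small_pair])
    next
      case (2 \<gamma>)
      then show ?thesis using \<alpha>[of \<gamma>] by (simp add: elts_vset[OF small_pair])
    next
      case 3
      then show ?thesis by blast
    next
      case 4
      then show ?thesis using Ord_trans[OF assms(1)] by blast
    qed
  qed
  have "elts \<alpha> \<lesssim> elts \<kappa>" by (rule subset_imp_lepoll) (rule subsetI, rule \<alpha>)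
  then have "g ` elts \<alpha> \<lesssim> elts \<kappa>" for g :: "'a \<Rightarrow> 'a"
    by (rule lepoll_trans[OF image_lepoll])
  then have "?T \<lesssim> elts \<kappa>"
    unfolding elts_code_fun using assms(2)
    by (intro Un_lepoll_infinite infinite_insert_lepoll)
  then show "?T \<prec> elts \<theta>"
    using Card_mem_lesspoll[OF assms(3,4)] by (rule lesspoll_trans1)
qed blast

lemma app_code_fun:
  assumes "Ord \<kappa>" "\<alpha> \<in> elts \<kappa>" "f ` elts \<alpha> \<subseteq> elts \<kappa>" "\<gamma> \<in> elts \<alpha>" "\<delta> \<in> elts \<kappa>"
    and N: "transitive_class N" "code_fun \<kappa> \<alpha> f \<in> N"
  shows "code_app N \<kappa> (code_fun \<kappa> \<alpha> f) \<gamma> \<delta> \<longleftrightarrow> \<delta> = f \<gamma>"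
proof
  assume "code_app N \<kappa> (code_fun \<kappa> \<alpha> f) \<gamma> \<delta>"
  then obtain p u where p: "p \<in> elts (code_fun \<kappa> \<alpha> f)" "\<delta> \<in> elts p"
    and u: "u \<in> elts p" "\<gamma> \<in> elts u" "\<kappa> \<in> elts u"
    unfolding code_app_def by blast
  from p(1) obtain \<gamma>' where g': "\<gamma>' \<in> elts \<alpha>" "p = vset {vset {\<gamma>', \<kappa>}, f \<gamma>'}"
    unfolding elts_code_fun by blast
  have f: "f \<gamma>' \<in> elts \<kappa>" using assms(3) g'(1) by blast
  have ep: "elts p = {vset {\<gamma>', \<kappa>}, f \<gamma>'}"
    unfolding g'(2) by (rule elts_vset[OF small_pair])
  have k: "\<kappa> \<in> elts (vset {\<gamma>', \<kappa>})" by (simp add: elts_vset[OF small_pair])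
  have "u \<noteq> f \<gamma>'" using u(3) f mem_asym by blast
  then have "u = vset {\<gamma>', \<kappa>}" using u(1) ep by blast
  then have "\<gamma> = \<gamma>' \<or> \<gamma> = \<kappa>" using u(2) by (simp add: elts_vset[OF small_pair])
  moreover have "\<gamma> \<noteq> \<kappa>"
    using Ord_trans[OF assms(1,2,4)] mem_irrefl[of \<kappa>] by blast
  moreover have "\<delta> \<noteq> vset {\<gamma>', \<kappa>}" using k assms(5) mem_asym by blast
  ultimately show "\<delta> = f \<gamma>" using p(2) ep by blast
next
  assume d: "\<delta> = f \<gamma>"
  define p where "p = vset {vset {\<gamma>, \<kappa>}, f \<gamma>}"
  have p: "p \<in> elts (code_fun \<kappa> \<alpha> f)"
    unfolding p_def elts_code_fun using assms(4) by (rule imageI)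
  have ep: "elts p = {vset {\<gamma>, \<kappa>}, f \<gamma>}"
    unfolding p_def by (rule elts_vset[OF small_pair])
  have N': "z \<in> N" if "y \<in> N" "z \<in> elts y" for y z
    using N(1) that unfolding transitive_class_def by blast
  have pN: "p \<in> N" by (rule N'[OF N(2) p])
  have uN: "vset {\<gamma>, \<kappa>} \<in> N" by (rule N'[OF pN]) (simp add: ep)
  show "code_app N \<kappa> (code_fun \<kappa> \<alpha> f) \<gamma> \<delta>"
    unfolding code_app_def
    by (rule bexI[OF _ pN], intro conjI p, simp add: ep d, rule bexI[OF _ uN])
       (simp add: ep elts_vset[OF small_pair])
qed

text \<open>Variables \<open>1\<close>, \<open>2\<close> and \<open>4\<close> hold the code, \<open>\<kappa>\<close> and the argument.\<close>

definition code_app_fm :: "nat \<Rightarrow> fm" where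
  "code_app_fm d = Ex 6 (Conj (Mem 6 1) (Conj (Mem d 6)
     (Ex 7 (Conj (Mem 7 6) (Conj (Mem 4 7) (Mem 2 7))))))"

lemma sat_code_app_fm [simp]:
  "d \<noteq> 6 \<Longrightarrow> d \<noteq> 7 \<Longrightarrow> sat N (code_app_fm d) s \<longleftrightarrow> code_app N (s 2) (s 1) (s 4) (s d)"
  by (simp add: code_app_fm_def code_app_def)

text \<open>Functionality of \<open>F\<close> is demanded at the arguments in question only; it makes the value \<open>\<delta>\<close> definable
  from \<open>F\<close>, \<open>\<gamma>\<close> and \<open>\<kappa>\<close>.\<close>

definition cofinal_code :: "'a::zfc set \<Rightarrow> 'a \<Rightarrow> 'a \<Rightarrow> 'a \<Rightarrow> bool" where
  "cofinal_code N \<kappa> F \<alpha> \<longleftrightarrow> (\<forall>\<beta>\<in>N. \<beta> \<in> elts \<kappa> \<longrightarrow>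
     (\<exists>\<gamma>\<in>N. \<gamma> \<in> elts \<alpha> \<and> (\<exists>\<delta>\<in>N. \<delta> \<in> elts \<kappa> \<and> \<delta> \<notin> elts \<beta> \<and> code_app N \<kappa> F \<gamma> \<delta> \<and>
        (\<forall>\<delta>'\<in>N. \<delta>' \<in> elts \<kappa> \<longrightarrow> code_app N \<kappa> F \<gamma> \<delta>' \<longrightarrow> \<delta>' = \<delta>))))"

text \<open>Variables \<open>0\<close>, \<open>1\<close> and \<open>2\<close> hold \<open>\<alpha>\<close>, \<open>F\<close> and \<open>\<kappa>\<close>.\<close>

definition cofinal_fm :: fm where
  "cofinal_fm = Forall 3 (Impl (Mem 3 2) (Ex 4 (Conj (Mem 4 0) (Ex 5 (Conj (Mem 5 2) (Conj (Neg (Mem 5 3))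
     (Conj (code_app_fm 5) (Forall 8 (Impl (Mem 8 2) (Impl (code_app_fm 8) (Eq 8 5)))))))))))"

lemma sat_cofinal_fm [simp]: "sat N cofinal_fm s \<longleftrightarrow> cofinal_code N (s 2) (s 1) (s 0)"
  by (simp add: cofinal_fm_def cofinal_code_def)

text \<open>A largest element of \<open>\<kappa>\<close> is definable from \<open>\<kappa>\<close>, so it would belong to \<open>X \<inter> \<kappa> = l\<close>, whereas \<open>l \<in> \<kappa>\<close>
  lies above all elements of \<open>l\<close>.\<close>

lemma elem_sub_no_max:
  fixes \<kappa> l \<theta> :: "'a::zfc"
  assumes X: "elem_sub X (H \<theta>)" and \<kappa>X: "\<kappa> \<in> X" and l: "l \<in> elts \<kappa>" "X \<inter> elts \<kappa> = elts l"
    and "\<alpha> \<in> elts \<kappa>"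
  shows "\<exists>\<beta>\<in>elts \<kappa>. \<alpha> \<in> elts \<beta>"
proof (rule ccontr)
  assume n: "\<not> ?thesis"
  have \<kappa>H: "\<kappa> \<in> H \<theta>" using X \<kappa>X by (auto dest: elem_sub_subset)
  let ?p = "Conj (Mem 0 1) (Forall 2 (Impl (Mem 2 1) (Neg (Mem 0 2))))"
  have s: "range (\<lambda>_::nat. \<kappa>) \<subseteq> X" using \<kappa>X by auto
  have "sat (H \<theta>) ?p ((\<lambda>_. \<kappa>)(0 := \<alpha>))" using n assms(5) by auto
  from elem_sub_witness[OF X s H_trans[OF \<kappa>H assms(5)] this]
  obtain \<beta> where "\<beta> \<in> X" "sat (H \<theta>) ?p ((\<lambda>_. \<kappa>)(0 := \<beta>))" .
  then have "\<beta> \<in> elts l" "\<forall>b\<in>H \<theta>. b \<in> elts \<kappa> \<longrightarrow> \<beta> \<notin> elts b" using l(2) by auto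
  then show False using H_trans[OF \<kappa>H l(1)] l(1) by blast
qed

text \<open>Witnesses in \<open>\<kappa>\<close> for parameters in \<open>X\<close> can be found in \<open>X \<inter> \<kappa> = l\<close>. Thus an unbounded subset of
  \<open>\<kappa>\<close> that belongs to \<open>X\<close> is unbounded in \<open>l\<close>.\<close>

lemma elem_sub_initial_segment:
  fixes \<kappa> l \<theta> :: "'a::zfc"
  assumes X: "elem_sub X (H \<theta>)" and \<kappa>X: "\<kappa> \<in> X" and l: "l \<in> elts \<kappa>" "X \<inter> elts \<kappa> = elts l"
  shows elem_sub_nonempty: "elts l \<noteq> {}"
    and elem_sub_limit: "\<And>C \<alpha>. C \<in> X \<Longrightarrow> elts C \<subseteq> elts \<kappa> \<Longrightarrow> \<alpha> \<in> elts l \<Longrightarrow>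
      \<exists>\<beta>\<in>elts C. \<alpha> \<in> elts \<beta> \<Longrightarrow> \<exists>\<beta>\<in>elts C \<inter> elts l. \<alpha> \<in> elts \<beta>"
proof -
  have H: "C \<in> H \<theta>" if "C \<in> X" for C using elem_sub_subset[OF X] that by blast
  have s: "range (\<lambda>_::nat. \<kappa>) \<subseteq> X" using \<kappa>X by auto
  have "sat (H \<theta>) (Mem 0 1) ((\<lambda>_. \<kappa>)(0 := l))" using l(1) by simp
  from elem_sub_witness[OF X s H_trans[OF H[OF \<kappa>X] l(1)] this]
  obtain b where "b \<in> X" "sat (H \<theta>) (Mem 0 1) ((\<lambda>_. \<kappa>)(0 := b))" .
  then show "elts l \<noteq> {}" using l(2) by auto
  fix C \<alpha> assume C: "C \<in> X" "elts C \<subseteq> elts \<kappa>" and \<alpha>: "\<alpha> \<in> elts l" and "\<exists>\<beta>\<in>elts C. \<alpha> \<in> elts \<beta>"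
  then obtain \<beta> where \<beta>: "\<beta> \<in> elts C" "\<alpha> \<in> elts \<beta>" by blast
  have "\<alpha> \<in> X" using \<alpha> l(2) by blast
  with C(1) have s: "range ((\<lambda>_::nat. C)(1 := \<alpha>)) \<subseteq> X" by auto
  let ?p = "Conj (Mem 0 2) (Mem 1 0)"
  have "sat (H \<theta>) ?p (((\<lambda>_. C)(1 := \<alpha>))(0 := \<beta>))" using \<beta> by simp
  from elem_sub_witness[OF X s H_trans[OF H[OF C(1)] \<beta>(1)] this]
  obtain b where "b \<in> X" "sat (H \<theta>) ?p (((\<lambda>_. C)(1 := \<alpha>))(0 := b))" .
  then show "\<exists>\<beta>\<in>elts C \<inter> elts l. \<alpha> \<in> elts \<beta>" using l(2) C(2) by auto
qed

text \<open>If \<open>\<kappa>\<close> is singular, some \<open>\<alpha> \<in> X \<inter> \<kappa> = l\<close> and some \<open>F \<in> X\<close> code a cofinal function from \<open>\<alpha>\<close> to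
  \<open>\<kappa>\<close>. Its arguments are below \<open>\<alpha> < l\<close> and so belong to \<open>X\<close>; hence so do its values, which are
  therefore below \<open>l\<close>, so that \<open>l < \<kappa>\<close> bounds them. If \<open>\<kappa>\<close> is countable, it is equipollent to
  the infinite ordinal \<open>l < \<kappa>\<close>.\<close>

lemma elem_sub_regular:
  fixes \<kappa> l \<theta> :: "'a::zfc"
  assumes card: "Card \<kappa>" "Card \<theta>" "\<kappa> \<in> elts \<theta>"
    and X: "elem_sub X (H \<theta>)" and \<kappa>X: "\<kappa> \<in> X" and l: "l \<in> elts \<kappa>" "X \<inter> elts \<kappa> = elts l"
  shows "regular_card \<kappa>" "uncountable (elts \<kappa>)"
proof -
  have \<kappa>: "Ord \<kappa>" using card(1) by (rule Card_Ord)
  have lO: "Ord l" using \<kappa> l(1) by (rule Ord_mem)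
  have XH: "X \<subseteq> H \<theta>" using X by (rule elem_sub_subset)
  have \<kappa>H: "\<kappa> \<in> H \<theta>" using \<kappa>X XH by blast
  note nomax = elem_sub_no_max[OF X \<kappa>X l]
  have inf: "infinite (elts \<kappa>)"
    by (rule infinite_if_no_max) (use l(1) nomax in auto)
  have "infinite (elts l)"
  proof (rule infinite_if_no_max)
    show "elts l \<noteq> {}" by (rule elem_sub_nonempty[OF X \<kappa>X l])
    fix \<alpha> assume a: "\<alpha> \<in> elts l"
    have "\<exists>\<beta>\<in>elts \<kappa>. \<alpha> \<in> elts \<beta>" using nomax[OF Ord_trans[OF \<kappa> l(1) a]] .
    from elem_sub_limit[OF X \<kappa>X l \<kappa>X subset_refl a this]
    show "\<exists>\<beta>\<in>elts l. \<alpha> \<in> elts \<beta>" by blast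
  qed
  then have natl: "(UNIV :: nat set) \<lesssim> elts l" by (simp add: infinite_le_lepoll)
  show "uncountable (elts \<kappa>)"
  proof
    assume "countable (elts \<kappa>)"
    then have "elts \<kappa> \<lesssim> (UNIV :: nat set)" by (auto simp: countable_def lepoll_def)
    also note natl
    also have "elts l \<prec> elts \<kappa>" using card(1) l(1) by (rule Card_mem_lesspoll)
    finally show False by simp
  qed
  have False if \<alpha>0: "\<alpha>0 \<in> elts \<kappa>" and f: "f ` elts \<alpha>0 \<subseteq> elts \<kappa>"
    and cof: "\<forall>\<beta>\<in>elts \<kappa>. \<exists>\<gamma>\<in>elts \<alpha>0. elts \<beta> \<subseteq> elts (f \<gamma>)" for \<alpha>0 f
  proof -
    define F0 where "F0 = code_fun \<kappa> \<alpha>0 f"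
    have F0: "F0 \<in> H \<theta>" unfolding F0_def by (rule code_fun_mem_H[OF \<kappa> inf card(2,3) \<alpha>0 f])
    have code_app: "code_app (H \<theta>) \<kappa> F0 \<gamma> \<delta> \<longleftrightarrow> \<delta> = f \<gamma>" if "\<gamma> \<in> elts \<alpha>0" "\<delta> \<in> elts \<kappa>" for \<gamma> \<delta>
      unfolding F0_def by (rule app_code_fun[OF \<kappa> \<alpha>0 f that transitive_H F0[unfolded F0_def]])
    have \<alpha>0H: "\<alpha>0 \<in> H \<theta>" by (rule H_trans[OF \<kappa>H \<alpha>0])
    have code: "cofinal_code (H \<theta>) \<kappa> F0 \<alpha>0"
      unfolding cofinal_code_def
    proof (intro ballI impI)
      fix \<beta> assume "\<beta> \<in> elts \<kappa>"
      then obtain \<gamma> where g: "\<gamma> \<in> elts \<alpha>0" "elts \<beta> \<subseteq> elts (f \<gamma>)" using cof by blast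
      have fg: "f \<gamma> \<in> elts \<kappa>" using f g(1) by blast
      have "f \<gamma> \<notin> elts \<beta>" using g(2) mem_irrefl[of "f \<gamma>"] by blast
      then show "\<exists>\<gamma>\<in>H \<theta>. \<gamma> \<in> elts \<alpha>0 \<and> (\<exists>\<delta>\<in>H \<theta>. \<delta> \<in> elts \<kappa> \<and> \<delta> \<notin> elts \<beta> \<and>
          code_app (H \<theta>) \<kappa> F0 \<gamma> \<delta> \<and> (\<forall>\<delta>'\<in>H \<theta>. \<delta>' \<in> elts \<kappa> \<longrightarrow> code_app (H \<theta>) \<kappa> F0 \<gamma> \<delta>' \<longrightarrow> \<delta>' = \<delta>))"
        using code_app[OF g(1)] fg g(1) H_trans[OF \<kappa>H fg] H_trans[OF \<alpha>0H g(1)]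
        by (intro bexI[of _ \<gamma>] bexI[of _ "f \<gamma>"] conjI) simp_all
    qed
    let ?s = "\<lambda>_::nat. \<kappa>"
    have s: "range ?s \<subseteq> X" using \<kappa>X by auto
    have "sat (H \<theta>) (Conj (Mem 0 2) (Ex 1 cofinal_fm)) (?s(0 := \<alpha>0))"
      using code F0 \<alpha>0 by auto
    \<comment> \<open>First a suitable \<open>\<alpha>\<close>, then a code \<open>F\<close> with this domain, are found in \<open>X\<close>.\<close>
    from elem_sub_witness[OF X s \<alpha>0H this]
    obtain \<alpha> where \<alpha>X: "\<alpha> \<in> X" and "sat (H \<theta>) (Conj (Mem 0 2) (Ex 1 cofinal_fm)) (?s(0 := \<alpha>))" .
    then have "\<alpha> \<in> elts \<kappa>" and ex: "\<exists>F\<in>H \<theta>. cofinal_code (H \<theta>) \<kappa> F \<alpha>" by auto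
    then have \<alpha>l: "\<alpha> \<in> elts l" using \<alpha>X l(2) by blast
    have s1: "range (?s(0 := \<alpha>)) \<subseteq> X" using s \<alpha>X by (rule range_upd)
    obtain F1 where "F1 \<in> H \<theta>" "sat (H \<theta>) cofinal_fm ((?s(0 := \<alpha>))(1 := F1))" using ex by auto
    from elem_sub_witness[OF X s1 this]
    obtain F where FX: "F \<in> X" and "sat (H \<theta>) cofinal_fm ((?s(0 := \<alpha>))(1 := F))" .
    then have "cofinal_code (H \<theta>) \<kappa> F \<alpha>" by simp
    \<comment> \<open>Cofinality, applied to the bound \<open>l\<close>, gives the argument with a value not below \<open>l\<close>.\<close>
    then obtain \<gamma> \<delta> where g: "\<gamma> \<in> elts \<alpha>" and d: "\<delta> \<in> H \<theta>" "\<delta> \<in> elts \<kappa>" "\<delta> \<notin> elts l" "code_app (H \<theta>) \<kappa> F \<gamma> \<delta>"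
      and unique: "\<forall>\<delta>'\<in>H \<theta>. \<delta>' \<in> elts \<kappa> \<longrightarrow> code_app (H \<theta>) \<kappa> F \<gamma> \<delta>' \<longrightarrow> \<delta>' = \<delta>"
      using H_trans[OF \<kappa>H l(1)] l(1) unfolding cofinal_code_def by blast
    have gX: "\<gamma> \<in> X" using Ord_trans[OF lO \<alpha>l g] l(2) by blast
    let ?t = "(?s(1 := F))(4 := \<gamma>)"
    have t: "range ?t \<subseteq> X" using s FX gX by (intro range_upd)
    have "sat (H \<theta>) (Conj (Mem 5 2) (code_app_fm 5)) (?t(5 := \<delta>))" using d by simp
    from elem_sub_witness[OF X t d(1) this]
    obtain \<delta>' where d': "\<delta>' \<in> X" "sat (H \<theta>) (Conj (Mem 5 2) (code_app_fm 5)) (?t(5 := \<delta>'))" .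
    then have "\<delta>' \<in> elts \<kappa>" "code_app (H \<theta>) \<kappa> F \<gamma> \<delta>'" by simp_all
    then have "\<delta>' = \<delta>" using unique d'(1) XH by blast
    then show False using d'(1) d(2,3) l(2) by blast
  qed
  then show "regular_card \<kappa>"
    unfolding regular_card_def using card(1) inf by blast
qed

text \<open>\<open>N\<close> believes that \<open>C\<close> is club in \<open>\<kappa>\<close> and has no element \<open>b\<close> with \<open>\<phi>(b,x)\<close>. In the formula,
  \<open>\<phi>\<close> keeps its variables \<open>0\<close> and \<open>1\<close>, while \<open>C\<close> and \<open>\<kappa>\<close> are held by \<open>2\<close> and \<open>3\<close>.\<close>

definition avoiding_club :: "'a::zfc set \<Rightarrow> fm \<Rightarrow> 'a \<Rightarrow> 'a \<Rightarrow> 'a \<Rightarrow> bool" where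
  "avoiding_club N \<phi> x \<kappa> C \<longleftrightarrow>
     (\<forall>b\<in>N. b \<in> elts C \<longrightarrow> b \<in> elts \<kappa> \<and> \<not> sat N \<phi> (\<lambda>i. if i = 0 then b else x)) \<and>
     (\<forall>a\<in>N. a \<in> elts \<kappa> \<longrightarrow> (\<exists>b\<in>N. b \<in> elts C \<and> a \<in> elts b)) \<and>
     (\<forall>d\<in>N. d \<in> elts \<kappa> \<and> (\<exists>a\<in>N. a \<in> elts d) \<and>
        (\<forall>a\<in>N. a \<in> elts d \<longrightarrow> (\<exists>b\<in>N. b \<in> elts C \<and> b \<in> elts d \<and> a \<in> elts b)) \<longrightarrow> d \<in> elts C)"

definition avoiding_club_fm :: "fm \<Rightarrow> fm" where
  "avoiding_club_fm \<phi> =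
     Conj (Forall 0 (Impl (Mem 0 2) (Conj (Mem 0 3) (Neg \<phi>))))
    (Conj (Forall 4 (Impl (Mem 4 3) (Ex 5 (Conj (Mem 5 2) (Mem 4 5)))))
          (Forall 6 (Impl (Conj (Mem 6 3) (Conj (Ex 4 (Mem 4 6))
             (Forall 4 (Impl (Mem 4 6) (Ex 5 (Conj (Mem 5 2) (Conj (Mem 5 6) (Mem 4 5)))))))) (Mem 6 2))))"

lemma sat_avoiding_club_fm:
  assumes "free_vars \<phi> \<subseteq> {0, 1}"
  shows "sat N (avoiding_club_fm \<phi>) s \<longleftrightarrow> avoiding_club N \<phi> (s 1) (s 3) (s 2)"
proof -
  have "sat N \<phi> (s(0 := b)) \<longleftrightarrow> sat N \<phi> (\<lambda>i. if i = 0 then b else s 1)" for b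
    using assms by (intro sat_cong) auto
  then show ?thesis
    by (simp add: avoiding_club_fm_def avoiding_club_def del: One_nat_def)
qed

text \<open>If a club avoids the set in question, then, as \<open>H(\<theta>)\<close> reflects \<open>\<phi>\<close>, the existence of such a club
  is expressible in \<open>H(\<theta>)\<close> with parameters \<open>\<kappa>\<close> and \<open>x\<close>, so there is one in \<open>X\<close>. It is
  unbounded in \<open>l\<close> and hence has \<open>l\<close> as an element, contrary to \<open>\<phi>(l,x)\<close>.\<close>

lemma elem_sub_stationary:
  fixes \<kappa> l \<theta> x :: "'a::zfc"
  assumes fv: "free_vars \<phi> \<subseteq> {0, 1}" and refl: "elem_sub (H \<theta>) UNIV"
    and card: "Card \<kappa>" "Card \<theta>" "\<kappa> \<in> elts \<theta>"
    and X: "elem_sub X (H \<theta>)" and \<kappa>X: "\<kappa> \<in> X" and l: "l \<in> elts \<kappa>" "X \<inter> elts \<kappa> = elts l"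
    and x: "x \<in> X" and \<phi>: "holds2 \<phi> l x"
  shows "stationary {l \<in> elts \<kappa>. Ord l \<and> holds2 \<phi> l x} \<kappa>"
proof (rule ccontr)
  assume "\<not> ?thesis"
  then obtain C where C: "club C \<kappa>" and avoid: "{l \<in> elts \<kappa>. Ord l \<and> holds2 \<phi> l x} \<inter> C = {}"
    unfolding stationary_def by blast
  have \<kappa>: "Ord \<kappa>" using card(1) by (rule Card_Ord)
  have XH: "X \<subseteq> H \<theta>" using X by (rule elem_sub_subset)
  have \<kappa>H: "\<kappa> \<in> H \<theta>" using \<kappa>X XH by blast
  have xH: "x \<in> H \<theta>" using x XH by blast
  have lH: "l \<in> H \<theta>" by (rule H_trans[OF \<kappa>H l(1)])
  have CK: "C \<subseteq> elts \<kappa>" using C by (simp add: club_def)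
  define C0 where "C0 = vset C"
  have C0: "elts C0 = C" unfolding C0_def by (rule elts_vset[OF small_subset[OF CK small_elts]])
  have C0H: "C0 \<in> H \<theta>"
  proof (rule H_I)
    show "transitive_class (elts \<kappa>)" using \<kappa> by (simp add: Ord_def)
    show "elts C0 \<subseteq> elts \<kappa>" using C0 CK by simp
    show "elts \<kappa> \<prec> elts \<theta>" by (rule Card_mem_lesspoll[OF card(2,3)])
  qed
  have sat: "sat (H \<theta>) \<phi> (\<lambda>i. if i = 0 then b else x) \<longleftrightarrow> holds2 \<phi> b x" if "b \<in> H \<theta>" for b
    unfolding holds2_def by (rule elem_sub_sat[OF refl]) (use that xH in auto)
  have inH: "b \<in> H \<theta>" if "b \<in> elts \<kappa>" for b by (rule H_trans[OF \<kappa>H that])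
  have "avoiding_club (H \<theta>) \<phi> x \<kappa> C0"
    unfolding avoiding_club_def C0
  proof (intro conjI ballI impI)
    fix b assume b: "b \<in> H \<theta>" "b \<in> C"
    then show "b \<in> elts \<kappa>" using CK by blast
    then have "Ord b" by (rule Ord_mem[OF \<kappa>])
    then show "\<not> sat (H \<theta>) \<phi> (\<lambda>i. if i = 0 then b else x)"
      using sat[OF b(1)] avoid b(2) \<open>b \<in> elts \<kappa>\<close> by blast
  next
    fix a assume "a \<in> elts \<kappa>"
    then obtain b where "b \<in> C" "b \<in> elts \<kappa>" "a \<in> elts b"
      using C unfolding club_def unbounded_in_def by blast
    then show "\<exists>b\<in>H \<theta>. b \<in> C \<and> a \<in> elts b" using inH by blast
  next
    fix d assume d: "d \<in> H \<theta>" "d \<in> elts \<kappa> \<and> (\<exists>a\<in>H \<theta>. a \<in> elts d) \<and>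
      (\<forall>a\<in>H \<theta>. a \<in> elts d \<longrightarrow> (\<exists>b\<in>H \<theta>. b \<in> C \<and> b \<in> elts d \<and> a \<in> elts b))"
    have "unbounded_in C d"
      unfolding unbounded_in_def using d H_trans[OF d(1)] by blast
    moreover have "elts d \<noteq> {}" using d(2) by blast
    ultimately show "d \<in> C" using C d(2) unfolding club_def by blast
  qed
  let ?s = "(\<lambda>_::nat. \<kappa>)(1 := x)"
  have s: "range ?s \<subseteq> X" using \<kappa>X x by auto
  have "sat (H \<theta>) (avoiding_club_fm \<phi>) (?s(2 := C0))"
    using \<open>avoiding_club (H \<theta>) \<phi> x \<kappa> C0\<close> by (simp add: sat_avoiding_club_fm[OF fv])
  from elem_sub_witness[OF X s C0H this]
  obtain D where D: "D \<in> X" "sat (H \<theta>) (avoiding_club_fm \<phi>) (?s(2 := D))" .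
  then have av: "avoiding_club (H \<theta>) \<phi> x \<kappa> D" by (simp add: sat_avoiding_club_fm[OF fv])
  have DH: "D \<in> H \<theta>" using D(1) XH by blast
  have D\<kappa>: "elts D \<subseteq> elts \<kappa>"
    using av H_trans[OF DH] unfolding avoiding_club_def by blast
  have ne: "elts l \<noteq> {}" by (rule elem_sub_nonempty[OF X \<kappa>X l])
  have unb: "\<exists>b\<in>H \<theta>. b \<in> elts D \<and> b \<in> elts l \<and> a \<in> elts b" if a: "a \<in> elts l" for a
  proof -
    have ak: "a \<in> elts \<kappa>" by (rule Ord_trans[OF \<kappa> l(1) a])
    have "\<exists>b\<in>elts D. a \<in> elts b"
      using av inH[OF ak] ak unfolding avoiding_club_def by blast
    from elem_sub_limit[OF X \<kappa>X l D(1) D\<kappa> a this]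
    show ?thesis using H_trans[OF DH] by blast
  qed
  have "\<exists>a\<in>H \<theta>. a \<in> elts l" using ne H_trans[OF lH] by blast
  then have "l \<in> elts D"
    using av lH l(1) unb unfolding avoiding_club_def by blast
  then have "\<not> sat (H \<theta>) \<phi> (\<lambda>i. if i = 0 then l else x)"
    using av lH unfolding avoiding_club_def by blast
  then show False using sat[OF lH] \<phi> by blast
qed

text \<open>A single embedding suffices, provided that its \<open>\<theta>\<close> is chosen such that \<open>H(\<theta>)\<close> reflects
  the universe.\<close>

lemma small_embeddings_imp_stationary:
  fixes \<phi> :: fm and \<kappa> x \<alpha> :: "'a::zfc"
  assumes "free_vars \<phi> \<subseteq> {0, 1}" "Ord \<alpha>"
    and emb: "\<And>\<theta>. Card \<theta> \<Longrightarrow> \<alpha> \<in> elts \<theta> \<Longrightarrow>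
      \<exists>M j. small_embedding \<kappa> \<theta> M j \<and> holds2 \<phi> (crit j (elts M)) x \<and> x \<in> j ` elts M"
  shows "regular_card \<kappa> \<and> uncountable (elts \<kappa>) \<and>
    stationary {l \<in> elts \<kappa>. Ord l \<and> holds2 \<phi> l x} \<kappa>"
proof -
  obtain \<theta> where \<theta>: "Card \<theta>" "\<alpha> \<in> elts \<theta>" "elem_sub (H \<theta>) UNIV"
    using reflection[OF assms(2)] by blast
  obtain M j where j: "small_embedding \<kappa> \<theta> M j" "holds2 \<phi> (crit j (elts M)) x" "x \<in> j ` elts M"
    using emb[OF \<theta>(1,2)] by blast
  have card: "Card \<kappa>" "\<kappa> \<in> elts \<theta>" using j(1) by (simp_all add: small_embedding_def)
  note X = small_embedding_range[OF j(1)]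
  show ?thesis
    using elem_sub_regular[OF card(1) \<theta>(1) card(2) X(1,3,2,4)]
      elem_sub_stationary[OF assms(1) \<theta>(3) card(1) \<theta>(1) card(2) X(1,3,2,4) j(3,2)] by simp
qed


section \<open>Bounded subsets of regular cardinals\<close>

text \<open>A subset of size less than \<open>\<kappa>\<close> is the range of a function on some smaller ordinal, which is not
  cofinal.\<close>

lemma regular_card_bounded:
  fixes \<kappa> :: "'a::zfc"
  assumes reg: "regular_card \<kappa>" and B: "B \<subseteq> elts \<kappa>" "B \<prec> elts \<kappa>"
  shows "\<exists>\<beta>\<in>elts \<kappa>. B \<subseteq> elts \<beta>"
proof -
  have \<kappa>: "Ord \<kappa>" using reg by (simp add: regular_card_def Card_Ord)
  obtain \<alpha> where \<alpha>: "\<alpha> \<in> elts \<kappa>" "elts \<alpha> \<approx> B"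
    using lesspoll_Ord[OF B(2) \<kappa>] by (elim bexE)
  then obtain f where "bij_betw f (elts \<alpha>) B" unfolding eqpoll_def by (elim exE)
  then have f: "f ` elts \<alpha> = B" by (rule bij_betw_imp_surj_on)
  then have "\<not> (\<forall>\<beta>\<in>elts \<kappa>. \<exists>\<gamma>\<in>elts \<alpha>. elts \<beta> \<subseteq> elts (f \<gamma>))"
    using reg \<alpha>(1) B(1) unfolding regular_card_def by blast
  then obtain \<beta> where \<beta>: "\<beta> \<in> elts \<kappa>" "\<And>\<gamma>. \<gamma> \<in> elts \<alpha> \<Longrightarrow> \<not> elts \<beta> \<subseteq> elts (f \<gamma>)" by blast
  have "b \<in> elts \<beta>" if b: "b \<in> B" for b
  proof -
    obtain \<gamma> where "\<gamma> \<in> elts \<alpha>" "b = f \<gamma>" using b f by blast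
    then have "\<not> elts \<beta> \<subseteq> elts b" using \<beta>(2) by simp
    moreover have "Ord b" "Ord \<beta>" using b B(1) \<beta>(1) Ord_mem[OF \<kappa>] by blast+
    ultimately show ?thesis using Ord_not_mem[of \<beta> b] by simp
  qed
  then show ?thesis using \<beta>(1) by blast
qed

lemma hull_lesspoll:
  assumes "A \<prec> K" "uncountable K"
  shows "hull N A \<prec> K"
proof (cases "infinite A")
  case True
  then have "hull N A \<lesssim> A" by (rule hull_lepoll) simp
  then show ?thesis using assms(1) by (rule lesspoll_trans1)
next
  case False
  have K: "infinite K" using assms(2) countable_finite by metis
  have "(UNIV :: nat set) \<prec> K"
  proof -
    have "\<not> (UNIV :: nat set) \<approx> K"
      using assms(2) countable_eqpoll[of "UNIV :: nat set" K] eqpoll_sym[of UNIV K] by auto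
    then show ?thesis using K by (simp add: lesspoll_def infinite_le_lepoll[symmetric])
  qed
  moreover have "hull N A \<lesssim> (UNIV :: nat set)"
    using False by (intro hull_lepoll finite_lepoll_infinite) simp_all
  ultimately show ?thesis by (rule lesspoll_trans1[rotated])
qed

lemma Un_finite_lesspoll:
  assumes "A \<prec> K" "finite P" "infinite K"
  shows "A \<union> P \<prec> K"
proof (cases "infinite A")
  case True
  then have "A \<union> P \<lesssim> A"
    using assms(2) by (intro Un_lepoll_infinite lepoll_refl finite_lepoll_infinite)
  then show ?thesis using assms(1) by (rule lesspoll_trans1)
next
  case False
  then show ?thesis using assms(2,3) by (intro finite_lesspoll_infinite) simp_all
qed


section \<open>The club of closure points of a Skolem hull\<close>

text \<open>Closedness holds because hulls commute with unions of chains. Unboundedness holds because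
  hulls of sets of size less than \<open>\<kappa>\<close> meet \<open>\<kappa>\<close> in bounded sets: \<open>\<omega>\<close> iterations of taking such bounds
  lead to a closure point, which is below \<open>\<kappa>\<close> since \<open>\<kappa>\<close> has uncountable cofinality.\<close>

lemma club_hull:
  fixes \<kappa> :: "'a::zfc"
  assumes reg: "regular_card \<kappa>" and unc: "uncountable (elts \<kappa>)" and P: "finite P"
  shows "club {l \<in> elts \<kappa>. hull N (elts l \<union> P) \<inter> elts \<kappa> \<subseteq> elts l} \<kappa>" (is "club ?C \<kappa>")
proof -
  have card: "Card \<kappa>" and inf: "infinite (elts \<kappa>)"
    using reg by (simp_all add: regular_card_def)
  have \<kappa>: "Ord \<kappa>" using card by (rule Card_Ord)
  have "\<exists>\<delta>'\<in>elts \<kappa>. \<delta> \<in> elts \<delta>' \<and> hull N (elts \<delta> \<union> P) \<inter> elts \<kappa> \<subseteq> elts \<delta>'" if \<delta>: "\<delta> \<in> elts \<kappa>" for \<delta>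
  proof -
    \<comment> \<open>Adding \<open>\<delta>\<close> to the generators makes the bound of the hull lie strictly above \<open>\<delta>\<close>.\<close>
    let ?B = "hull N (elts \<delta> \<union> insert \<delta> P) \<inter> elts \<kappa>"
    have "hull N (elts \<delta> \<union> insert \<delta> P) \<prec> elts \<kappa>"
      using P Card_mem_lesspoll[OF card \<delta>] inf unc by (intro hull_lesspoll Un_finite_lesspoll) simp_all
    then have "?B \<prec> elts \<kappa>"
      by (rule lesspoll_trans1[OF subset_imp_lepoll[OF Int_lower1]])
    from regular_card_bounded[OF reg Int_lower2 this]
    obtain \<delta>' where \<delta>': "\<delta>' \<in> elts \<kappa>" "?B \<subseteq> elts \<delta>'"
      by (elim bexE)
    have "\<delta> \<in> ?B" using \<delta> by (intro IntI hull_base) simp_all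
    moreover have "hull N (elts \<delta> \<union> P) \<inter> elts \<kappa> \<subseteq> ?B"
      by (intro Int_mono hull_mono) auto
    ultimately show ?thesis using \<delta>' by (intro bexI[of _ \<delta>']) auto
  qed
  then obtain g where g: "\<And>\<delta>. \<delta> \<in> elts \<kappa> \<Longrightarrow> g \<delta> \<in> elts \<kappa> \<and> \<delta> \<in> elts (g \<delta>) \<and>
      hull N (elts \<delta> \<union> P) \<inter> elts \<kappa> \<subseteq> elts (g \<delta>)"
    by metis
  have "\<exists>l\<in>?C \<inter> elts \<kappa>. \<alpha> \<in> elts l" if \<alpha>: "\<alpha> \<in> elts \<kappa>" for \<alpha>
  proof -
    define a where "a n = (g ^^ n) \<alpha>" for n
    have a0: "a 0 = \<alpha>" and aS: "a (Suc n) = g (a n)" for n by (simp_all add: a_def)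
    have a\<kappa>: "a n \<in> elts \<kappa>" for n by (induction n) (simp_all add: a0 aS \<alpha> g)
    have aO: "Ord (a n)" for n by (rule Ord_mem[OF \<kappa> a\<kappa>])
    have step: "a n \<in> elts (a (Suc n))" "hull N (elts (a n) \<union> P) \<inter> elts \<kappa> \<subseteq> elts (a (Suc n))" for n
      unfolding aS using g[OF a\<kappa>] by simp_all
    have mono: "elts (a m) \<subseteq> elts (a n)" if "m \<le> n" for m n
    proof (rule lift_Suc_mono_le[of "\<lambda>n. elts (a n)", OF _ that])
      show "elts (a n) \<subseteq> elts (a (Suc n))" for n
        by (rule subsetI) (rule Ord_trans[OF aO step(1)])
    qed
    define l where "l = vset (\<Union>n. elts (a n))"
    have l: "elts l = (\<Union>n. elts (a n))"
      unfolding l_def by (rule elts_vset, rule small_UN_nat, rule small_elts)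
    have lO: "Ord l"
      unfolding Ord_def transitive_class_def l
    proof (intro conjI ballI subsetI)
      fix y z assume "y \<in> (\<Union>n. elts (a n))" and z: "z \<in> elts y"
      then obtain n where "y \<in> elts (a n)" by (elim UN_E)
      from Ord_trans[OF aO this z] show "z \<in> (\<Union>n. elts (a n))" by (rule UN_I[OF UNIV_I])
    next
      fix y z w assume "y \<in> (\<Union>n. elts (a n))" and z: "z \<in> elts y" and w: "w \<in> elts z"
      then obtain n where "y \<in> elts (a n)" by (elim UN_E)
      then have "Ord y" by (rule Ord_mem[OF aO])
      from Ord_trans[OF this z w] show "w \<in> elts y" .
    qed
    have "range a \<prec> elts \<kappa>"
    proof -
      have "\<not> range a \<approx> elts \<kappa>"
        using unc countable_eqpoll[of "range a" "elts \<kappa>"] eqpoll_sym[of "range a" "elts \<kappa>"] by auto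
      moreover have "range a \<lesssim> elts \<kappa>" using a\<kappa> by (intro subset_imp_lepoll) auto
      ultimately show ?thesis by (simp add: lesspoll_def)
    qed
    then obtain \<beta> where \<beta>: "\<beta> \<in> elts \<kappa>" "range a \<subseteq> elts \<beta>"
      using regular_card_bounded[OF reg, of "range a"] a\<kappa> by (auto simp: image_subset_iff)
    have \<beta>O: "Ord \<beta>" by (rule Ord_mem[OF \<kappa> \<beta>(1)])
    have "elts l \<subseteq> elts \<beta>"
      unfolding l using Ord_trans[OF \<beta>O subsetD[OF \<beta>(2) rangeI]] by (intro UN_least subsetI)
    then have "l \<in> elts \<beta> \<or> l = \<beta>" using Ord_subset_iff[OF lO \<beta>O] by simp
    then have l\<kappa>: "l \<in> elts \<kappa>" using \<beta>(1) Ord_trans[OF \<kappa> \<beta>(1)] by blast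
    have "elts l \<union> P = \<Union>(range (\<lambda>n. elts (a n) \<union> P))"
      unfolding l by simp
    then have "hull N (elts l \<union> P) \<subseteq> (\<Union>A\<in>range (\<lambda>n. elts (a n) \<union> P). hull N A)"
    proof (simp only:, intro hull_Union_chain)
      fix A B assume A: "A \<in> range (\<lambda>n. elts (a n) \<union> P)" and B: "B \<in> range (\<lambda>n. elts (a n) \<union> P)"
      obtain m n where "A = elts (a m) \<union> P" "B = elts (a n) \<union> P" using A B by (elim rangeE)
      then show "A \<subseteq> B \<or> B \<subseteq> A"
        using nat_le_linear[of m n] mono[of m n] mono[of n m] by auto
    qed simp
    moreover have "hull N (elts (a n) \<union> P) \<inter> elts \<kappa> \<subseteq> elts l" for n
      unfolding l using step(2)[of n] by (rule subset_trans) (rule UN_upper, simp)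
    ultimately have "hull N (elts l \<union> P) \<inter> elts \<kappa> \<subseteq> elts l" by blast
    moreover have "\<alpha> \<in> elts l"
      unfolding l using step(1)[of 0] a0 by (intro UN_I[of "Suc 0"]) simp_all
    ultimately show ?thesis using l\<kappa> by (intro bexI[of _ l]) simp_all
  qed
  then have unb: "unbounded_in ?C \<kappa>" unfolding unbounded_in_def by (rule ballI)
  have closed: "\<delta> \<in> ?C" if \<delta>: "\<delta> \<in> elts \<kappa>" "elts \<delta> \<noteq> {}" "unbounded_in ?C \<delta>" for \<delta>
  proof -
    have \<delta>O: "Ord \<delta>" by (rule Ord_mem[OF \<kappa> \<delta>(1)])
    let ?D = "?C \<inter> elts \<delta>"
    let ?\<C> = "(\<lambda>\<gamma>. elts \<gamma> \<union> P) ` ?D"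
    have ne: "?D \<noteq> {}" using \<delta>(2,3) unfolding unbounded_in_def by blast
    have "elts \<delta> \<subseteq> \<Union>?\<C>" using \<delta>(3) unfolding unbounded_in_def by blast
    moreover have "P \<subseteq> \<Union>?\<C>" using ne by blast
    ultimately have "hull N (elts \<delta> \<union> P) \<subseteq> hull N (\<Union>?\<C>)" by (intro hull_mono Un_least)
    also have "\<dots> \<subseteq> (\<Union>A\<in>?\<C>. hull N A)"
    proof (rule hull_Union_chain)
      fix A B assume A: "A \<in> ?\<C>" and B: "B \<in> ?\<C>"
      obtain \<alpha> \<beta> where ab: "A = elts \<alpha> \<union> P" "B = elts \<beta> \<union> P" "\<alpha> \<in> elts \<delta>" "\<beta> \<in> elts \<delta>"
        using A B by blast
      have "Ord \<alpha>" "Ord \<beta>" using ab(3,4) Ord_mem[OF \<delta>O] by simp_all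
      then have "elts \<alpha> \<subseteq> elts \<beta> \<or> elts \<beta> \<subseteq> elts \<alpha>"
        using Ord_comparable[of \<alpha> \<beta>] Ord_subset_iff[of \<alpha> \<beta>] Ord_subset_iff[of \<beta> \<alpha>] by auto
      then show "A \<subseteq> B \<or> B \<subseteq> A" using ab(1,2) by auto
    qed (use ne in simp)
    finally have sub: "hull N (elts \<delta> \<union> P) \<subseteq> (\<Union>A\<in>?\<C>. hull N A)" .
    have "hull N (elts \<delta> \<union> P) \<inter> elts \<kappa> \<subseteq> elts \<delta>"
    proof
      fix u assume u: "u \<in> hull N (elts \<delta> \<union> P) \<inter> elts \<kappa>"
      then obtain \<gamma> where "\<gamma> \<in> ?D" "u \<in> hull N (elts \<gamma> \<union> P)" using sub by blast
      then have "\<gamma> \<in> elts \<delta>" "u \<in> elts \<gamma>" using u by blast+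
      then show "u \<in> elts \<delta>" by (rule Ord_trans[OF \<delta>O])
    qed
    then show ?thesis using \<delta>(1) by simp
  qed
  show ?thesis
    unfolding club_def using unb closed by blast
qed


section \<open>Collapsing an elementary substructure\<close>

text \<open>An element of \<open>x\<close> outside \<open>y\<close> can be found in \<open>X\<close>, so elements of \<open>X\<close> are determined by their
  elements in \<open>X\<close>, and the collapse of \<open>X\<close> is injective.\<close>

lemma elem_sub_extensional:
  assumes X: "elem_sub X N" and N: "transitive_class N" and x: "x \<in> X" and y: "y \<in> X"
    and sub: "elts x \<inter> X \<subseteq> elts y"
  shows "elts x \<subseteq> elts y"
proof (rule ccontr)
  assume "\<not> ?thesis"
  then obtain z where z: "z \<in> elts x" "z \<notin> elts y" by blast
  then have zN: "z \<in> N" using N x elem_sub_subset[OF X] unfolding transitive_class_def by blast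
  have s: "range ((\<lambda>_::nat. x)(1 := y)) \<subseteq> X" using x y by auto
  let ?p = "Conj (Mem 0 2) (Neg (Mem 0 1))"
  have "sat N ?p (((\<lambda>_::nat. x)(1 := y))(0 := z))" using z by simp
  from elem_sub_witness[OF X s zN this]
  obtain b where "b \<in> X" "sat N ?p (((\<lambda>_::nat. x)(1 := y))(0 := b))" .
  then show False using sub by auto
qed

text \<open>Converse of \<open>small_embedding_range\<close>: the inverse \<open>j\<close> of the transitive collapse of \<open>X\<close> is a small
  embedding. The collapse fixes the elements of the transitive part \<open>l\<close> of \<open>X\<close>, hence maps \<open>\<kappa>\<close> to
  \<open>X \<inter> \<kappa> = l\<close>, so that \<open>l\<close> is the critical point of \<open>j\<close>. The collapsed set belongs to \<open>H(\<theta>)\<close> by its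
  size.\<close>

lemma small_embedding_collapse:
  fixes \<kappa> \<theta> l :: "'a::zfc"
  assumes card: "Card \<kappa>" "Card \<theta>" "\<kappa> \<in> elts \<theta>"
    and X: "elem_sub X (H \<theta>)" and less: "X \<prec> elts \<kappa>"
    and \<kappa>X: "\<kappa> \<in> X" and l: "l \<in> elts \<kappa>" "X \<inter> elts \<kappa> = elts l"
  shows "\<exists>M j. small_embedding \<kappa> \<theta> M j \<and> crit j (elts M) = l \<and> j ` elts M = X"
proof -
  have \<kappa>: "Ord \<kappa>" using card(1) by (rule Card_Ord)
  have lO: "Ord l" by (rule Ord_mem[OF \<kappa> l(1)])
  have smallX: "small X" using lesspoll_imp_lepoll[OF less] by (rule small_lepoll)
  define R where "R = {(y, x). y \<in> elts x} \<inter> X \<times> X"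
  have "wf R" unfolding R_def by (rule wf_subset[OF wf_mem]) simp
  moreover have "small {y. (y, x) \<in> R}" for x
    by (rule small_subset[OF _ smallX]) (auto simp: R_def)
  ultimately obtain c :: "'a \<Rightarrow> 'a" where "\<forall>x. elts (c x) = c ` {y. (y, x) \<in> R}"
    using ex_collapse by metis
  then have c: "elts (c x) = c ` (elts x \<inter> X)" if "x \<in> X" for x
  proof -
    have "{y. (y, x) \<in> R} = elts x \<inter> X" using that unfolding R_def by blast
    then show ?thesis using \<open>\<forall>x. elts (c x) = c ` {y. (y, x) \<in> R}\<close> by simp
  qed
  have inj: "x = y" if "x \<in> X" "y \<in> X" "c x = c y" for x y
    using that
  proof (induction x arbitrary: y rule: mem_induct)
    case (mem x)
    have eq: "c ` (elts x \<inter> X) = c ` (elts y \<inter> X)"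
      using c[OF mem.prems(1)] c[OF mem.prems(2)] mem.prems(3) by simp
    have "elts x \<inter> X \<subseteq> elts y"
    proof
      fix z assume z: "z \<in> elts x \<inter> X"
      then have "c z \<in> c ` (elts y \<inter> X)" using eq by blast
      then obtain z' where z': "z' \<in> elts y" "z' \<in> X" "c z = c z'" by blast
      have "z = z'" using mem.IH[of z z'] z z' by simp
      then show "z \<in> elts y" using z'(1) by simp
    qed
    moreover have "elts y \<inter> X \<subseteq> elts x"
    proof
      fix z assume z: "z \<in> elts y \<inter> X"
      then have "c z \<in> c ` (elts x \<inter> X)" using eq by blast
      then obtain z' where z': "z' \<in> elts x" "z' \<in> X" "c z' = c z" by force
      have "z' = z" using mem.IH[of z' z] z z' by simp
      then show "z \<in> elts x" using z'(1) by simp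
    qed
    ultimately have "elts x = elts y"
      using elem_sub_extensional[OF X transitive_H] mem.prems(1,2) by (intro equalityI)
    then show ?case by (rule extensionality)
  qed
  then have inj_on: "inj_on c X" by (rule inj_onI)
  have mem: "c x \<in> elts (c y) \<longleftrightarrow> x \<in> elts y" if "x \<in> X" "y \<in> X" for x y
    unfolding c[OF that(2)] using inj that by blast
  have lX: "\<beta> \<in> X" if "\<beta> \<in> elts l" for \<beta> using l(2) that by blast
  have fixed: "c \<beta> = \<beta>" if "\<beta> \<in> elts l" for \<beta>
    using that
  proof (induction \<beta> rule: mem_induct)
    case (mem \<beta>)
    have sub: "\<gamma> \<in> elts l" if "\<gamma> \<in> elts \<beta>" for \<gamma> using Ord_trans[OF lO mem.prems that] .
    then have "elts \<beta> \<inter> X = elts \<beta>" using lX by blast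
    then have "elts (c \<beta>) = c ` elts \<beta>" using c[OF lX[OF mem.prems]] by simp
    also have "\<dots> = elts \<beta>" using mem.IH sub by (intro image_cong[where g = "\<lambda>x. x", simplified]) simp_all
    finally show ?case by (rule extensionality)
  qed
  have c\<kappa>: "c \<kappa> = l"
  proof (rule extensionality)
    have "elts (c \<kappa>) = c ` elts l" using c[OF \<kappa>X] l(2) by (simp add: Int_commute)
    also have "\<dots> = elts l" using fixed by (intro image_cong[where g = "\<lambda>x. x", simplified]) simp_all
    finally show "elts (c \<kappa>) = elts l" .
  qed
  define M where "M = vset (c ` X)"
  have M: "elts M = c ` X" unfolding M_def by (rule elts_vset[OF small_image[OF smallX]])
  define j where "j = inv_into X c"
  have jc: "j (c x) = x" if "x \<in> X" for x
    unfolding j_def using inj_on that by (rule inv_into_f_f)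
  have cj: "c (j y) = y" and jX: "j y \<in> X" if "y \<in> elts M" for y
    using that jc by (auto simp: M)
  have jM: "j ` elts M = X" unfolding M image_image using jc by simp
  have trM: "transitive_class (elts M)"
    unfolding transitive_class_def
  proof (intro ballI)
    fix y assume y: "y \<in> elts M"
    then have "elts y = c ` (elts (j y) \<inter> X)" using c[OF jX[OF y]] cj[OF y] by simp
    then show "elts y \<subseteq> elts M" unfolding M by blast
  qed
  have MH: "M \<in> H \<theta>"
  proof (rule H_I[OF trM subset_refl])
    have "elts M \<lesssim> X" unfolding M by (rule image_lepoll)
    also have "X \<prec> elts \<kappa>" by (rule less)
    also have "elts \<kappa> \<prec> elts \<theta>" using card(2,3) by (rule Card_mem_lesspoll)
    finally show "elts M \<prec> elts \<theta>" .
  qed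
  have el: "elementary_embedding j (elts M) (H \<theta>)"
    unfolding elementary_embedding_def
  proof (intro conjI allI impI)
    show "j ` elts M \<subseteq> H \<theta>" unfolding jM by (rule elem_sub_subset[OF X])
    fix p and s :: "nat \<Rightarrow> 'a" assume s: "range s \<subseteq> elts M"
    have r: "range (j \<circ> s) \<subseteq> X" using s jX by auto
    have "c \<circ> (j \<circ> s) = s" using s cj by (auto simp: fun_eq_iff)
    then have "sat (elts M) p s \<longleftrightarrow> sat (c ` X) p (c \<circ> (j \<circ> s))" by (simp add: M)
    also have "\<dots> \<longleftrightarrow> sat X p (j \<circ> s)" by (rule sat_isomorphic[OF inj_on mem r])
    also have "\<dots> \<longleftrightarrow> sat (H \<theta>) p (j \<circ> s)" by (rule elem_sub_sat[OF X r])
    finally show "sat (elts M) p s \<longleftrightarrow> sat (H \<theta>) p (j \<circ> s)" .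
  qed
  have jl: "j l = \<kappa>" using jc[OF \<kappa>X] c\<kappa> by simp
  have lM: "l \<in> elts M" unfolding M using \<kappa>X c\<kappa> by blast
  have jfix: "j \<beta> = \<beta>" if "\<beta> \<in> elts l" for \<beta>
    using jc[OF lX[OF that]] fixed[OF that] by simp
  have least: "elts l \<subseteq> elts \<beta>" if \<beta>: "\<beta> \<in> elts M" "Ord \<beta> \<and> \<beta> \<in> elts (j \<beta>)" for \<beta>
  proof -
    have "\<beta> \<notin> elts l" using jfix[of \<beta>] \<beta>(2) mem_irrefl[of \<beta>] by auto
    then show ?thesis using Ord_not_mem[OF lO, of \<beta>] \<beta>(2) by simp
  qed
  have crit: "crit j (elts M) = l"
    unfolding crit_def
  proof (rule the_equality)
    show "l \<in> elts M \<and> Ord l \<and> l \<in> elts (j l) \<and>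
        (\<forall>\<beta>\<in>elts M. Ord \<beta> \<and> \<beta> \<in> elts (j \<beta>) \<longrightarrow> elts l \<subseteq> elts \<beta>)"
      using lM lO l(1) jl least by simp
    fix l' assume l': "l' \<in> elts M \<and> Ord l' \<and> l' \<in> elts (j l') \<and>
        (\<forall>\<beta>\<in>elts M. Ord \<beta> \<and> \<beta> \<in> elts (j \<beta>) \<longrightarrow> elts l' \<subseteq> elts \<beta>)"
    have "elts l' \<subseteq> elts l" using l' lM lO l(1) jl by simp
    moreover have "elts l \<subseteq> elts l'" using l' least by simp
    ultimately show "l' = l" by (intro extensionality equalityI)
  qed
  have "nontrivial j (elts M)"
    unfolding nontrivial_def using lM lO l(1) jl by (intro bexI[of _ l]) simp_all
  then have "small_embedding \<kappa> \<theta> M j"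
    unfolding small_embedding_def using card MH trM el crit jl by simp
  then show ?thesis using crit jM by blast
qed

text \<open>A stationary set contains a closure point \<open>l\<close> of the Skolem hull in \<open>H(\<theta>)\<close> with additional
  generators \<open>\<kappa>\<close> and \<open>x\<close>; the hull of \<open>l\<close> then meets \<open>\<kappa>\<close> in \<open>l\<close> and can be collapsed.\<close>

lemma stationary_imp_small_embedding:
  fixes \<kappa> \<theta> x :: "'a::zfc"
  assumes reg: "regular_card \<kappa>" and unc: "uncountable (elts \<kappa>)" and S: "stationary S \<kappa>"
    and \<theta>: "Card \<theta>" "\<kappa> \<in> elts \<theta>" and x: "x \<in> H \<theta>"
  shows "\<exists>M j. small_embedding \<kappa> \<theta> M j \<and> crit j (elts M) \<in> S \<and> x \<in> j ` elts M"
proof -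
  have card: "Card \<kappa>" and inf: "infinite (elts \<kappa>)"
    using reg by (simp_all add: regular_card_def)
  have "club {l \<in> elts \<kappa>. hull (H \<theta>) (elts l \<union> {\<kappa>, x}) \<inter> elts \<kappa> \<subseteq> elts l} \<kappa>"
    using reg unc by (rule club_hull) simp
  then obtain l where lS: "l \<in> S" and l: "l \<in> elts \<kappa>"
    and sub: "hull (H \<theta>) (elts l \<union> {\<kappa>, x}) \<inter> elts \<kappa> \<subseteq> elts l"
    using S unfolding stationary_def by blast
  define X where "X = hull (H \<theta>) (elts l \<union> {\<kappa>, x})"
  have gen: "elts l \<union> {\<kappa>, x} \<subseteq> X" unfolding X_def using hull_base[where N = "H \<theta>"] by (rule subsetI)
  have l\<kappa>: "elts l \<subseteq> elts \<kappa>" using Ord_trans[OF Card_Ord[OF card] l] by (rule subsetI)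
  have \<kappa>H: "\<kappa> \<in> H \<theta>" using \<theta> by (rule Card_mem_H)
  have "elts l \<union> {\<kappa>, x} \<subseteq> H \<theta>" using x \<kappa>H l\<kappa> H_trans[OF \<kappa>H] by blast
  moreover have "H \<theta> \<noteq> {}" using x by blast
  ultimately have X: "elem_sub X (H \<theta>)" unfolding X_def by (rule elem_sub_hull)
  have less: "X \<prec> elts \<kappa>"
    unfolding X_def using Card_mem_lesspoll[OF card l] inf unc
    by (intro hull_lesspoll Un_finite_lesspoll) simp_all
  have int: "X \<inter> elts \<kappa> = elts l"
  proof
    show "X \<inter> elts \<kappa> \<subseteq> elts l" unfolding X_def by (rule sub)
    show "elts l \<subseteq> X \<inter> elts \<kappa>" using gen l\<kappa> by blast
  qed
  have \<kappa>X: "\<kappa> \<in> X" and xX: "x \<in> X" using gen by simp_all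
  obtain M j where "small_embedding \<kappa> \<theta> M j" "crit j (elts M) = l" "j ` elts M = X"
    using small_embedding_collapse[OF card \<theta> X less \<kappa>X l int] by (elim exE conjE)
  then show ?thesis using lS xX by (intro exI[of _ M] exI[of _ j]) simp
qed

text \<open>A cardinal \<open>\<mu>\<close> as below serves as the bound beyond which all cardinals are sufficiently large.\<close>

lemma ex_Card_mem_H:
  fixes \<kappa> x :: "'a::zfc"
  assumes "Ord \<kappa>"
  shows "\<exists>\<mu>. Card \<mu> \<and> \<kappa> \<in> elts \<mu> \<and> x \<in> H \<mu>"
  using ex_Card_greater[OF assms, of "vset (trcl x)"]
  unfolding H_def elts_vset[OF small_trcl] by simp


section \<open>The characterisation\<close>

theorem lemma2p1:
  fixes \<phi> :: fm and \<kappa> x :: "'a::zfc"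
  assumes "free_vars \<phi> \<subseteq> {0, 1}"
    and "Card \<kappa>"
  shows "(regular_card \<kappa> \<and> uncountable (elts \<kappa>) \<and>
            stationary {l \<in> elts \<kappa>. Ord l \<and> holds2 \<phi> l x} \<kappa>)
         \<longleftrightarrow>
         (\<exists>\<alpha>. Ord \<alpha> \<and> elts \<kappa> \<subseteq> elts \<alpha> \<and>
            (\<forall>\<theta>. Card \<theta> \<and> \<alpha> \<in> elts \<theta> \<longrightarrow>
               (\<exists>M j. small_embedding \<kappa> \<theta> M j \<and>
                  holds2 \<phi> (crit j (elts M)) x \<and> x \<in> j ` elts M)))"
proof
  assume S: "regular_card \<kappa> \<and> uncountable (elts \<kappa>) \<and>
    stationary {l \<in> elts \<kappa>. Ord l \<and> holds2 \<phi> l x} \<kappa>"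
  have \<kappa>: "Ord \<kappa>" using assms(2) by (rule Card_Ord)
  obtain \<mu> where \<mu>: "Card \<mu>" "\<kappa> \<in> elts \<mu>" "x \<in> H \<mu>"
    using ex_Card_mem_H[OF \<kappa>] by blast
  have \<mu>O: "Ord \<mu>" using \<mu>(1) by (rule Card_Ord)
  have "\<exists>M j. small_embedding \<kappa> \<theta> M j \<and> holds2 \<phi> (crit j (elts M)) x \<and> x \<in> j ` elts M"
    if \<theta>: "Card \<theta>" "\<mu> \<in> elts \<theta>" for \<theta>
  proof -
    have sub: "elts \<mu> \<subseteq> elts \<theta>"
      by (rule subsetI) (rule Ord_trans[OF Card_Ord[OF \<theta>(1)] \<theta>(2)])
    then have "\<kappa> \<in> elts \<theta>" "x \<in> H \<theta>"
      using \<mu>(2) subsetD[OF H_mono[OF sub] \<mu>(3)] by blast+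
    then obtain M j where "small_embedding \<kappa> \<theta> M j"
      "crit j (elts M) \<in> {l \<in> elts \<kappa>. Ord l \<and> holds2 \<phi> l x}" "x \<in> j ` elts M"
      using stationary_imp_small_embedding S \<theta>(1) by blast
    then show ?thesis by blast
  qed
  moreover have "elts \<kappa> \<subseteq> elts \<mu>"
    by (rule subsetI) (rule Ord_trans[OF \<mu>O \<mu>(2)])
  ultimately show "\<exists>\<alpha>. Ord \<alpha> \<and> elts \<kappa> \<subseteq> elts \<alpha> \<and>
    (\<forall>\<theta>. Card \<theta> \<and> \<alpha> \<in> elts \<theta> \<longrightarrow>
      (\<exists>M j. small_embedding \<kappa> \<theta> M j \<and> holds2 \<phi> (crit j (elts M)) x \<and> x \<in> j ` elts M))"
    using \<mu>O by blast
next
  assume "\<exists>\<alpha>. Ord \<alpha> \<and> elts \<kappa> \<subseteq> elts \<alpha> \<and>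
    (\<forall>\<theta>. Card \<theta> \<and> \<alpha> \<in> elts \<theta> \<longrightarrow>
      (\<exists>M j. small_embedding \<kappa> \<theta> M j \<and> holds2 \<phi> (crit j (elts M)) x \<and> x \<in> j ` elts M))"
  then obtain \<alpha> where "Ord \<alpha>" and
    "\<And>\<theta>. Card \<theta> \<Longrightarrow> \<alpha> \<in> elts \<theta> \<Longrightarrow>
      \<exists>M j. small_embedding \<kappa> \<theta> M j \<and> holds2 \<phi> (crit j (elts M)) x \<and> x \<in> j ` elts M"
    by blast
  with assms(1) show "regular_card \<kappa> \<and> uncountable (elts \<kappa>) \<and>
    stationary {l \<in> elts \<kappa>. Ord l \<and> holds2 \<phi> l x} \<kappa>"
    by (rule small_embeddings_imp_stationary)
qed

end
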